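(* Let $H\in(0,\tfrac12)$, let $(B^H_t)_{t\ge 0}$ be a fractional Brownian motion with Hurst index $H$, let $x\in\mathbb{R}$, let $f\in C^{0,1}_b([0,\infty)\times\mathbb{R})$, and let $(X_t)_{t\ge 0}$ be a solution of $$X_t = x+\int_0^t f(s,X_s)\,ds + B^H_t,\qquad t\ge 0 .$$ Let $a=(a_0,\dots,a_p)$ be a filter with $p+1$ components. If $\alpha>\frac{1}{2(1-H)}$ and $\Delta=n^{-\alpha}$, then $$\sqrt{n}\,V(a,n,\Delta,X)\xrightarrow{(d)} N(0,\sigma_H)\qquad (n\to\infty),$$ where $\sigma_H>0$ is the variance of the limit in the central limit theorem for the quadratic $a$-variation of fractional Brownian motion.
   Context: Fractional Brownian motion $(B^H_t)_{t\in T}$ with Hurst index $H\in(0,1)$ on an interval $T$ is the centered Gaussian process with covariance $\mathbb{E}[B^H_tB^H_s]=\frac12(t^{2H}+s^{2H}-|t-s|^{2H})$. $f\in C^{0,1}_b(T\times\mathbb{R})$ means that $f(s,x)$ is continuous in the time component $s$, continuously differentiable in the space component $x$, and that $f$ and its derivative $f'$ with respect to the second variable are bounded, $\|f\|_\infty+\|f'\|_\infty\le M$ for a fixed constant $M>0$. A filter of length $p+1$ ($p\in\mathbb{N}$, $p\ge1$) is a tuple $a=(a_0,\dots,a_p)$ of real numbers with $\sum_{q=0}^p a_q=0$. Its order $M(a)$ is the order of its first non-zero moment: $\sum_{i=0}^p a_i i^k=0$ for $0\le k<M(a)$ and $\sum_{i=0}^p a_i i^{M(a)}\ne0$ (in particular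 $a$ is not identically zero). For a process $Z$ and mesh size $\Delta>0$ put $\Delta_aZ_j=\sum_{i=0}^p a_i Z_{(i+j)\Delta}$. Put $\sigma_{a,\Delta}=\operatorname{Var}(\Delta_aB^H_j)=-\frac{\Delta^{2H}}{2}\sum_{k,l=0}^p a_ka_l|k-l|^{2H}$. For $Z=X$ or $Z=B^H$ and $n>p$, the quadratic $a$-variation is $$V(a,n,\Delta,Z)=\frac1n\sum_{j=1}^{n-p}\left(\frac{(\Delta_aZ_j)^2}{\sigma_{a,\Delta}}-1\right).$$ The constant $\sigma_H>0$ (depending on $H$ and $a$) is the one from the known central limit theorem: if $M(a)>H+\frac14$, then $\sqrt n\,V(a,n,\Delta,B^H)\xrightarrow{(d)}N(0,\sigma_H)$, with $\Delta=n^{-\alpha}$. (For $H<\frac12$ every filter satisfies $M(a)>H+\frac14$.) Here $N(0,\sigma)$ is the centered normal law with variance $\sigma$, and $\xrightarrow{(d)}$ is convergence in distribution. *)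

theory Defs
  imports "HOL-Probability.Probability"
begin

(* Point masses count as (degenerate) Gaussians. *)
definition gaussian_rv :: "'a measure \<Rightarrow> ('a \<Rightarrow> real) \<Rightarrow> bool" where
  "gaussian_rv M Y \<longleftrightarrow> Y \<in> borel_measurable M \<and>
     (\<exists>\<mu>. (AE \<omega> in M. Y \<omega> = \<mu>) \<or>
          (\<exists>s>0. distributed M lborel Y (normal_density \<mu> s)))"

definition gaussian_process :: "'a measure \<Rightarrow> real set \<Rightarrow> (real \<Rightarrow> 'a \<Rightarrow> real) \<Rightarrow> bool" where
  "gaussian_process M T Z \<longleftrightarrow>
     (\<forall>J c. finite J \<and> J \<subseteq> T \<longrightarrow> gaussian_rv M (\<lambda>\<omega>. \<Sum>t\<in>J. c t * Z t \<omega>))"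

definition fBm :: "'a measure \<Rightarrow> real \<Rightarrow> (real \<Rightarrow> 'a \<Rightarrow> real) \<Rightarrow> bool" where
  "fBm M H B \<longleftrightarrow> prob_space M \<and> 0 < H \<and> H < 1 \<and> gaussian_process M {0..} B \<and>
     (\<forall>t\<ge>0. prob_space.expectation M (B t) = 0) \<and>
     (\<forall>s\<ge>0. \<forall>t\<ge>0. prob_space.expectation M (\<lambda>\<omega>. B t \<omega> * B s \<omega>) =
        (t powr (2*H) + s powr (2*H) - \<bar>t - s\<bar> powr (2*H)) / 2)"

(* The last conjunct is  sup |f| + sup |f'| \<le> K,  the two suprema being taken independently. *)
definition C01b :: "real set \<Rightarrow> (real \<Rightarrow> real \<Rightarrow> real) \<Rightarrow> bool" where
  "C01b T f \<longleftrightarrow>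
     (\<forall>x. continuous_on T (\<lambda>s. f s x)) \<and>
     (\<exists>f'. (\<forall>s\<in>T. \<forall>x. (f s has_real_derivative f' s x) (at x)) \<and>
           (\<forall>s\<in>T. continuous_on UNIV (f' s)) \<and>
           (\<exists>K>0. \<forall>s\<in>T. \<forall>x. \<forall>r\<in>T. \<forall>y. \<bar>f s x\<bar> + \<bar>f' r y\<bar> \<le> K))"

definition is_solution ::
  "'a measure \<Rightarrow> real \<Rightarrow> (real \<Rightarrow> real \<Rightarrow> real) \<Rightarrow> (real \<Rightarrow> 'a \<Rightarrow> real) \<Rightarrow> (real \<Rightarrow> 'a \<Rightarrow> real) \<Rightarrow> bool" where
  "is_solution M x f B X \<longleftrightarrow>
     (\<forall>t\<ge>0. X t \<in> borel_measurable M) \<and>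
     (AE \<omega> in M. \<forall>t\<ge>0. set_integrable lborel {0..t} (\<lambda>s. f s (X s \<omega>)) \<and>
        X t \<omega> = x + (LINT s:{0..t}|lborel. f s (X s \<omega>)) + B t \<omega>)"

(* A tuple (a_0, ..., a_p) is given by p and a function whose values above p are never used.
   Moments use the convention 0^0 = 1. *)
definition has_order :: "nat \<Rightarrow> (nat \<Rightarrow> real) \<Rightarrow> nat \<Rightarrow> bool" where
  "has_order p a m \<longleftrightarrow> (\<forall>k<m. (\<Sum>i\<le>p. a i * real i ^ k) = 0) \<and> (\<Sum>i\<le>p. a i * real i ^ m) \<noteq> 0"

definition is_diff_filter :: "nat \<Rightarrow> (nat \<Rightarrow> real) \<Rightarrow> bool" where
  "is_diff_filter p a \<longleftrightarrow> 1 \<le> p \<and> (\<Sum>q\<le>p. a q) = 0 \<and> (\<exists>m. has_order p a m)"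

definition filter_diff :: "nat \<Rightarrow> (nat \<Rightarrow> real) \<Rightarrow> real \<Rightarrow> (real \<Rightarrow> 'a \<Rightarrow> real) \<Rightarrow> nat \<Rightarrow> 'a \<Rightarrow> real" where
  "filter_diff p a \<Delta> Z j \<omega> = (\<Sum>i\<le>p. a i * Z (real (i + j) * \<Delta>) \<omega>)"

definition filter_var :: "real \<Rightarrow> nat \<Rightarrow> (nat \<Rightarrow> real) \<Rightarrow> real \<Rightarrow> real" where
  "filter_var H p a \<Delta> =
     - (\<Delta> powr (2*H) / 2) * (\<Sum>k\<le>p. \<Sum>l\<le>p. a k * a l * \<bar>real k - real l\<bar> powr (2*H))"

(* For n \<le> p the sum is empty; only the limit n \<rightarrow> \<infinity> matters below. *)
definition quad_var ::
  "real \<Rightarrow> nat \<Rightarrow> (nat \<Rightarrow> real) \<Rightarrow> nat \<Rightarrow> real \<Rightarrow> (real \<Rightarrow> 'a \<Rightarrow> real) \<Rightarrow> 'a \<Rightarrow> real" where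
  "quad_var H p a n \<Delta> Z \<omega> =
     (1 / real n) * (\<Sum>j=1..n-p. ((filter_diff p a \<Delta> Z j \<omega>)\<^sup>2 / filter_var H p a \<Delta> - 1))"

(* N(0, v), parametrised by the variance; normal_density takes the standard deviation. *)
definition centered_normal :: "real \<Rightarrow> real measure" where
  "centered_normal v = density lborel (normal_density 0 (sqrt v))"

definition conv_in_distr :: "'a measure \<Rightarrow> (nat \<Rightarrow> 'a \<Rightarrow> real) \<Rightarrow> real measure \<Rightarrow> bool" where
  "conv_in_distr M Y L \<longleftrightarrow> weak_conv_m (\<lambda>n. distr M borel (Y n)) L"

(* The variance of the limit in the central limit theorem for the quadratic variation of fractional
   Brownian motion. The law of  quad_var  of B is determined by H and the filter, so nothing is lost
   by letting the probability space range over measures on the path space  real \<Rightarrow> real.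
   That such a v exists is the central limit theorem itself, valid for filters of order > H + 1/4
   (hence for all filters if H < 1/2); uniqueness is that of weak limits. *)
definition clt_variance :: "real \<Rightarrow> nat \<Rightarrow> (nat \<Rightarrow> real) \<Rightarrow> real" where
  "clt_variance H p a = (THE v. 0 < v \<and>
     (\<forall>(M :: (real \<Rightarrow> real) measure) B \<alpha>. fBm M H B \<and> 0 < \<alpha> \<longrightarrow>
        conv_in_distr M (\<lambda>n \<omega>. sqrt (real n) * quad_var H p a n (real n powr (-\<alpha>)) B \<omega>)
          (centered_normal v)))"

lemma gaussian_rv_square_integrable:
  assumes "prob_space M" "gaussian_rv M Y"
  shows "integrable M (\<lambda>\<omega>. (Y \<omega>)\<^sup>2)"
proof -
  interpret prob_space M by fact
  have Ym [measurable]: "Y \<in> borel_measurable M"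
    using assms(2) by (simp add: gaussian_rv_def)
  from assms(2) obtain \<mu> where "(AE \<omega> in M. Y \<omega> = \<mu>) \<or>
      (\<exists>s>0. distributed M lborel Y (normal_density \<mu> s))"
    by (auto simp: gaussian_rv_def)
  then show ?thesis
  proof
    assume "AE \<omega> in M. Y \<omega> = \<mu>"
    then have "integrable M (\<lambda>\<omega>. (Y \<omega>)\<^sup>2) \<longleftrightarrow> integrable M (\<lambda>\<omega>. \<mu>\<^sup>2)"
      by (intro integrable_cong_AE) auto
    then show ?thesis by simp
  next
    assume "\<exists>s>0. distributed M lborel Y (normal_density \<mu> s)"
    then obtain s where s: "0 < s" and D: "distributed M lborel Y (normal_density \<mu> s)"
      by blast
    have "integrable lborel (\<lambda>x. normal_density \<mu> s x * (x - \<mu>)^2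
        + 2 * \<mu> * (normal_density \<mu> s x * x) - \<mu>\<^sup>2 * normal_density \<mu> s x)"
      using s by (intro Bochner_Integration.integrable_add Bochner_Integration.integrable_diff
          integrable_mult_right integrable_normal_moment integrable_normal_moment_nz_1
          integrable_normal_density)
    moreover have "(\<lambda>x. normal_density \<mu> s x * (x - \<mu>)^2
        + 2 * \<mu> * (normal_density \<mu> s x * x) - \<mu>\<^sup>2 * normal_density \<mu> s x)
        = (\<lambda>x. normal_density \<mu> s x * x\<^sup>2)"
      by (auto simp: power2_eq_square algebra_simps)
    ultimately show ?thesis
      using distributed_integrable[OF D, of "\<lambda>x. x\<^sup>2"] by auto
  qed
qed

lemma fBm_gaussian_sum:
  assumes "fBm M H B" "finite J" "J \<subseteq> {0..}"
  shows "gaussian_rv M (\<lambda>\<omega>. \<Sum>t\<in>J. c t * B t \<omega>)"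
proof -
  have "gaussian_process M {0..} B" using assms(1) by (simp add: fBm_def)
  with assms show ?thesis by (auto simp: gaussian_process_def)
qed

lemma fBm_integrable:
  assumes "fBm M H B" "0 \<le> s" "0 \<le> t"
  shows "integrable M (\<lambda>\<omega>. B s \<omega> * B t \<omega>)" and "integrable M (B t)"
proof -
  interpret prob_space M using assms by (simp add: fBm_def)
  have 1: "gaussian_rv M (B u)" if "0 \<le> u" for u
    using fBm_gaussian_sum[OF assms(1), of "{u}" "\<lambda>_. 1"] that by simp
  have sq: "integrable M (\<lambda>\<omega>. (B u \<omega>)\<^sup>2)" if "0 \<le> u" for u
    using gaussian_rv_square_integrable[OF prob_space_axioms 1[OF that]] .
  have [measurable]: "B t \<in> borel_measurable M" "B s \<in> borel_measurable M"
    using 1 assms by (auto simp: gaussian_rv_def)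
  show "integrable M (B t)"
    using sq[OF assms(3)] by (rule square_integrable_imp_integrable[rotated]) simp
  show "integrable M (\<lambda>\<omega>. B s \<omega> * B t \<omega>)"
  proof (cases "s = t")
    case True
    then show ?thesis using sq[OF assms(2)] by (simp add: power2_eq_square)
  next
    case False
    then have "gaussian_rv M (\<lambda>\<omega>. B s \<omega> + B t \<omega>)"
      using fBm_gaussian_sum[OF assms(1), of "{s,t}" "\<lambda>_. 1"] assms by simp
    then have "integrable M (\<lambda>\<omega>. ((B s \<omega> + B t \<omega>)\<^sup>2 - (B s \<omega>)\<^sup>2 - (B t \<omega>)\<^sup>2) / 2)"
      using sq assms gaussian_rv_square_integrable[OF prob_space_axioms]
      by (intro integrable_divide_zero Bochner_Integration.integrable_diff) auto
    then show ?thesis by (simp add: power2_sum)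
  qed
qed

lemma filter_var_eq_variance:
  assumes B: "fBm M H B" and a: "(\<Sum>q\<le>p. a q) = 0" and \<Delta>: "0 < \<Delta>"
  shows "prob_space.variance M (filter_diff p a \<Delta> B j) = filter_var H p a \<Delta>"
proof -
  interpret prob_space M using B by (simp add: fBm_def)
  define \<tau> where "\<tau> i = real (i + j) * \<Delta>" for i
  have \<tau>: "0 \<le> \<tau> i" for i using \<Delta> by (simp add: \<tau>_def)
  have int: "integrable M (\<lambda>\<omega>. B (\<tau> k) \<omega> * B (\<tau> l) \<omega>)" "integrable M (B (\<tau> k))" for k l
    using fBm_integrable[OF B \<tau> \<tau>] by auto
  have mean: "expectation (B (\<tau> k)) = 0" for k
    using B \<tau>[of k] unfolding fBm_def by blast
  have cov: "expectation (\<lambda>\<omega>. B (\<tau> k) \<omega> * B (\<tau> l) \<omega>) =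
      (\<tau> k powr (2*H) + \<tau> l powr (2*H) - \<bar>\<tau> k - \<tau> l\<bar> powr (2*H)) / 2" for k l
    using B \<tau>[of k] \<tau>[of l] unfolding fBm_def by blast
  have "expectation (filter_diff p a \<Delta> B j) = (\<Sum>i\<le>p. a i * expectation (B (\<tau> i)))"
    unfolding filter_diff_def \<tau>_def[symmetric] using int by simp
  also have "\<dots> = 0" by (simp add: mean)
  finally have E: "expectation (filter_diff p a \<Delta> B j) = 0" .
  have diff: "\<bar>\<tau> k - \<tau> l\<bar> powr (2*H) = \<Delta> powr (2*H) * \<bar>real k - real l\<bar> powr (2*H)" for k l
  proof -
    have "\<tau> k - \<tau> l = \<Delta> * (real k - real l)" by (simp add: \<tau>_def algebra_simps)
    then show ?thesis using \<Delta> by (simp add: abs_mult powr_mult)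
  qed
  have "variance (filter_diff p a \<Delta> B j)
      = expectation (\<lambda>\<omega>. \<Sum>k\<le>p. \<Sum>l\<le>p. a k * a l * (B (\<tau> k) \<omega> * B (\<tau> l) \<omega>))"
    unfolding E by (simp add: filter_diff_def \<tau>_def power2_eq_square sum_product algebra_simps)
  also have "\<dots> = (\<Sum>k\<le>p. \<Sum>l\<le>p. a k * a l * expectation (\<lambda>\<omega>. B (\<tau> k) \<omega> * B (\<tau> l) \<omega>))"
    using int by (simp add: Bochner_Integration.integral_sum)
  also have "\<dots> = (\<Sum>k\<le>p. \<Sum>l\<le>p. a k * a l *
      ((\<tau> k powr (2*H) + \<tau> l powr (2*H) - \<bar>\<tau> k - \<tau> l\<bar> powr (2*H)) / 2))"
    by (simp only: cov)
  also have "\<dots> = (\<Sum>k\<le>p. \<Sum>l\<le>p. (a k * \<tau> k powr (2*H) / 2) * a l + a k * (a l * \<tau> l powr (2*H) / 2)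
      - (\<Delta> powr (2*H) / 2) * (a k * a l * \<bar>real k - real l\<bar> powr (2*H)))"
    unfolding diff by (intro sum.cong refl) (simp add: field_simps)
  also have "\<dots> = (\<Sum>k\<le>p. a k * \<tau> k powr (2*H) / 2) * (\<Sum>l\<le>p. a l)
      + (\<Sum>k\<le>p. a k) * (\<Sum>l\<le>p. a l * \<tau> l powr (2*H) / 2)
      - (\<Delta> powr (2*H) / 2) * (\<Sum>k\<le>p. \<Sum>l\<le>p. a k * a l * \<bar>real k - real l\<bar> powr (2*H))"
    by (simp only: sum.distrib sum_subtractf sum_product
        sum_distrib_left[of "\<Delta> powr (2*H) / 2"])
  also have "\<dots> = filter_var H p a \<Delta>"
    unfolding a filter_var_def by simp
  finally show ?thesis .
qed

end

(* The increments of X and of the driving process differ by O(Delta), because the drift is bounded.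
   After multiplication by sqrt n the two quadratic variations therefore differ in L^1 by
   O(n^(1/2 - alpha (1 - H))), which tends to 0 exactly when alpha > 1 / (2 (1 - H)), and it remains
   to prove the central limit theorem for fractional Brownian motion.

   For H < 1/2 the function |x|^(2H) is concave on the half line, so the correlations of fractional
   Gaussian noise are negative off the diagonal and their sum telescopes. Summation by parts writes
   a filter difference as a combination of such increments; its correlations are summable, and
   diagonal dominance shows that its variance is positive. A Gaussian vector with covariance matrix
   Gamma of spectral norm at most R is diagonalised, and the characteristic function of its squared
   norm is the product of those of l_k g^2, where l_k runs through the eigenvalues and g is standard
   normal. Since sum l_k = trace Gamma, sum l_k^2 = sum of squared correlations and l_k <= R, a
   third order expansion of each factor gives the Gaussian limit.

   The product formula avoids multivariate densities: exp(- k y^2) is a mixture of iexp(w y), so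
   from E[V iexp(w Y)] = 0 for all w one gets E[V p(exp(- k Y^2))] = 0 for polynomials p, and then
   E[V iexp(t Y^2)] = 0 by the Weierstrass theorem. *)
theory Submission
  imports Defs "HOL-Real_Asymp.Real_Asymp"
begin

section \<open>Spectral decomposition of symmetric matrices\<close>

text \<open>\<open>gaussian_process\<close> describes only the law of one linear combination at a
  time, possibly a point mass, so no joint density is at hand; every joint statement is drawn from
  one-dimensional characteristic functions. By self-similarity the mesh size cancels in the
  correlations of filter differences, so \<alpha> matters only in the comparison of \<open>X\<close>
  with \<open>B\<close>. The limit variance is 2, the variance of the square of a standard normal
  variable, times the limit of the sum of all squared correlations divided by n; for a Toeplitz
  matrix that limit is the sum of the squared correlations over all integer lags. \<open>X\<close>
  is not assumed Gaussian, so the majorant of the difference of the two variations is built from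
  \<open>B\<close> alone. Finally, \<open>clt_variance\<close> is a definite description that
  quantifies over measures on path space: besides the limit theorem on all of them, its evaluation
  takes one fractional Brownian motion that lives there, since otherwise every positive number would
  satisfy the description.\<close>

lemma compact_box_nat_fun:
  "compact {x :: nat \<Rightarrow> real. \<forall>i. x i \<in> (if i < N then {-1..1} else {0})}"
proof -
  have "compactin (product_topology (\<lambda>_. euclidean) UNIV)
      (PiE UNIV (\<lambda>i. if i < N then {-1..1::real} else {0}))"
    by (subst compactin_PiE) auto
  then show ?thesis
    by (simp add: euclidean_product_topology PiE_UNIV_domain Pi_def)
qed

context
  fixes A :: "nat \<Rightarrow> nat \<Rightarrow> real" and N :: nat
  assumes sym: "\<And>i j. i < N \<Longrightarrow> j < N \<Longrightarrow> A i j = A j i"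
begin

text \<open>The dimension \<open>N\<close> is a term, since it will grow with n; vectors are
  functions on all naturals of which only the coordinates below \<open>N\<close> count. Hence
  \<open>dot\<close> is definite only up to these coordinates.\<close>

private definition dot :: "(nat \<Rightarrow> real) \<Rightarrow> (nat \<Rightarrow> real) \<Rightarrow> real" where
  "dot x y = (\<Sum>i<N. x i * y i)"

private definition app :: "(nat \<Rightarrow> real) \<Rightarrow> nat \<Rightarrow> real" where
  "app x i = (\<Sum>j<N. A i j * x j)"

private lemma dot_simps:
  "dot (\<lambda>i. x i + y i) z = dot x z + dot y z" "dot z (\<lambda>i. x i + y i) = dot z x + dot z y"
  "dot (\<lambda>i. x i - y i) z = dot x z - dot y z" "dot z (\<lambda>i. x i - y i) = dot z x - dot z y"
  "dot (\<lambda>i. c * x i) z = c * dot x z" "dot z (\<lambda>i. c * x i) = c * dot z x"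
  by (auto simp: dot_def algebra_simps sum.distrib sum_subtractf sum_distrib_left)

private lemma dot_commute: "dot x y = dot y x"
  by (simp add: dot_def mult.commute)

private lemma dot_self_nonneg: "0 \<le> dot x x"
  by (auto simp: dot_def intro: sum_nonneg)

private lemma dot_self_eq_0: "dot x x = 0 \<longleftrightarrow> (\<forall>i<N. x i = 0)"
  by (auto simp: dot_def sum_nonneg_eq_0_iff)

private lemma app_simps:
  "app (\<lambda>i. x i + y i) = (\<lambda>i. app x i + app y i)" "app (\<lambda>i. c * x i) = (\<lambda>i. c * app x i)"
  by (auto simp: app_def algebra_simps sum.distrib sum_distrib_left)

private lemma dot_app_commute: "dot (app x) y = dot x (app y)"
proof -
  have "dot (app x) y = (\<Sum>i<N. \<Sum>j<N. A i j * x j * y i)"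
    by (simp add: dot_def app_def sum_distrib_right)
  also have "\<dots> = (\<Sum>j<N. \<Sum>i<N. A i j * x j * y i)"
    by (rule sum.swap)
  also have "\<dots> = (\<Sum>j<N. \<Sum>i<N. x j * (A j i * y i))"
    by (intro sum.cong refl) (simp add: sym)
  finally show ?thesis
    by (simp add: dot_def app_def sum_distrib_left)
qed

private lemma continuous_dot [continuous_intros]:
  assumes "\<And>i. continuous_on S (\<lambda>x. f x i)" "\<And>i. continuous_on S (\<lambda>x. g x i)"
  shows "continuous_on S (\<lambda>x. dot (f x) (g x))"
  unfolding dot_def by (intro continuous_intros assms)

text \<open>Here \<open>x\<close> is the \<open>i\<close>-th unit vector minus its projection onto
  the span of the \<open>e k\<close>; as \<open>x\<close> is orthogonal to that projection,
  \<open>dot x x\<close> is just the coordinate \<open>x i\<close>.\<close>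

private lemma orthonormal_residual:
  fixes m :: nat
  assumes orth: "\<And>k l. k < m \<Longrightarrow> l < m \<Longrightarrow> dot (e k) (e l) = (if k = l then 1 else 0)"
    and i: "i < N"
  defines "x \<equiv> \<lambda>j. (if j = i then 1 else 0) - (\<Sum>k<m. e k i * e k j)"
  shows "dot x x = 1 - (\<Sum>k<m. (e k i)\<^sup>2)" and "k < m \<Longrightarrow> dot x (e k) = 0"
proof -
  have s: "dot (\<lambda>j. \<Sum>k<m. e k i * e k j) z = (\<Sum>k<m. e k i * dot (e k) z)" for z
    unfolding dot_def sum_distrib_right sum_distrib_left
    by (subst sum.swap) (simp add: mult.assoc)
  have d: "dot (\<lambda>j. if j = i then 1 else 0) z = z i" for z
  proof -
    have "dot (\<lambda>j. if j = i then 1 else 0) z = (\<Sum>j<N. if j = i then z j else 0)"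
      unfolding dot_def by (intro sum.cong) auto
    then show ?thesis using i by simp
  qed
  have 0: "dot x (e k) = 0" if "k < m" for k
  proof -
    have "dot x (e k) = e k i - (\<Sum>l<m. e l i * dot (e l) (e k))"
      unfolding x_def dot_simps d s ..
    also have "(\<Sum>l<m. e l i * dot (e l) (e k)) = (\<Sum>l<m. if l = k then e l i else 0)"
      using that by (intro sum.cong) (auto simp: orth)
    finally show ?thesis using that by simp
  qed
  then show "k < m \<Longrightarrow> dot x (e k) = 0" .
  have "dot x x = dot (\<lambda>j. if j = i then 1 else 0) x - dot (\<lambda>j. \<Sum>k<m. e k i * e k j) x"
    by (subst (1) x_def) (simp only: dot_simps)
  also have "\<dots> = x i"
    unfolding d s using 0 by (simp add: dot_commute)
  finally show "dot x x = 1 - (\<Sum>k<m. (e k i)\<^sup>2)"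
    by (simp add: x_def power2_eq_square)
qed

text \<open>Counting the squares along rows and along columns replaces dimension theory. For
  \<open>m < N\<close> a positive total exposes a unit vector outside the span; for
  \<open>m = N\<close> a zero total forces completeness.\<close>

private lemma sum_orthonormal_squares:
  assumes orth: "\<And>k l. k < m \<Longrightarrow> l < m \<Longrightarrow> dot (e k) (e l) = (if k = l then 1 else 0)"
  shows "(\<Sum>i<N. 1 - (\<Sum>k<m. (e k i)\<^sup>2)) = real N - real m"
proof -
  have "(\<Sum>i<N. \<Sum>k<m. (e k i)\<^sup>2) = (\<Sum>k<m. dot (e k) (e k))"
    unfolding dot_def by (subst sum.swap) (simp add: power2_eq_square)
  also have "\<dots> = real m" by (simp add: orth)
  finally show ?thesis by (simp add: sum_subtractf)
qed

private lemma exists_orthogonal_unit_vector: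
  assumes orth: "\<And>k l. k < m \<Longrightarrow> l < m \<Longrightarrow> dot (e k) (e l) = (if k = l then 1 else 0)"
    and m: "m < N"
  shows "\<exists>x. dot x x = 1 \<and> (\<forall>k<m. dot x (e k) = 0)"
proof -
  have "\<exists>i<N. 0 < 1 - (\<Sum>k<m. (e k i)\<^sup>2)"
  proof (rule ccontr)
    assume "\<not> ?thesis"
    then have "(\<Sum>i<N. 1 - (\<Sum>k<m. (e k i)\<^sup>2)) \<le> 0"
      by (intro sum_nonpos) (meson lessThan_iff not_less)
    then show False
      using sum_orthonormal_squares[OF orth] m by simp
  qed
  then obtain i where i: "i < N" and pos: "0 < 1 - (\<Sum>k<m. (e k i)\<^sup>2)" by blast
  define y where "y = (\<lambda>j. (if j = i then 1 else 0) - (\<Sum>k<m. e k i * e k j))"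
  have y: "dot y y = 1 - (\<Sum>k<m. (e k i)\<^sup>2)" "\<And>k. k < m \<Longrightarrow> dot y (e k) = 0"
    unfolding y_def using orthonormal_residual[OF orth i] by blast+
  define c where "c = 1 / sqrt (dot y y)"
  have "dot (\<lambda>j. c * y j) (\<lambda>j. c * y j) = 1"
  proof -
    have "c * c = 1 / dot y y"
      using pos by (simp add: c_def y(1))
    then show ?thesis
      using pos by (simp add: dot_simps y(1) flip: mult.assoc)
  qed
  moreover have "\<forall>k<m. dot (\<lambda>j. c * y j) (e k) = 0"
    using y(2) by (simp add: dot_simps)
  ultimately show ?thesis by blast
qed

text \<open>The next eigenvector maximises the Rayleigh quotient on the orthogonal complement of the
  previous ones.\<close>

private lemma next_eigenvector:
  assumes orth: "\<And>k l. k < m \<Longrightarrow> l < m \<Longrightarrow> dot (e k) (e l) = (if k = l then 1 else 0)"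
    and eig: "\<And>k i. k < m \<Longrightarrow> i < N \<Longrightarrow> app (e k) i = l k * e k i"
    and m: "m < N"
  shows "\<exists>v \<mu>. dot v v = 1 \<and> (\<forall>k<m. dot v (e k) = 0) \<and> (\<forall>i<N. app v i = \<mu> * v i)"
proof -
  \<comment> \<open>The coordinates from \<open>N\<close> on are pinned to 0, because the product
    topology on all functions gives compactness only if every coordinate is confined. The box costs
    nothing: unit vectors have their coordinates in it.\<close>
  define K where "K = {x. \<forall>i. x i \<in> (if i < N then {-1..1} else {0::real})}
      \<inter> ({x. dot x x = 1} \<inter> (\<Inter>k\<in>{..<m}. {x. dot x (e k) = 0}))"
  have "compact K"
  proof -
    have "closed {x. dot x x = 1}" "closed {x. dot x (e k) = 0}" for k
      by (intro closed_Collect_eq continuous_dot continuous_on_const continuous_on_product_coordinates)+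
    then show ?thesis
      unfolding K_def by (intro compact_Int_closed compact_box_nat_fun closed_Int closed_INT ballI)
  qed
  have in_K: "(\<lambda>i. if i < N then x i else 0) \<in> K" if "dot x x = 1" "\<forall>k<m. dot x (e k) = 0" for x
  proof -
    have "\<bar>x i\<bar> \<le> 1" if "i < N" for i
    proof -
      have "(x i)\<^sup>2 \<le> (\<Sum>i<N. x i * x i)"
        using that member_le_sum[of i "{..<N}" "\<lambda>i. x i * x i"] by (simp add: power2_eq_square)
      then show ?thesis
        using \<open>dot x x = 1\<close> by (simp add: dot_def abs_le_square_iff[of "x i" 1, simplified])
    qed
    moreover have "dot (\<lambda>i. if i < N then x i else 0) (\<lambda>i. if i < N then x i else 0) = dot x x"
      "dot (\<lambda>i. if i < N then x i else 0) (e k) = dot x (e k)" for k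
      by (auto simp: dot_def intro!: sum.cong)
    ultimately show ?thesis
      using that by (auto simp: K_def abs_le_iff minus_le_iff)
  qed
  have "K \<noteq> {}"
    using exists_orthogonal_unit_vector[OF orth m] in_K by blast
  moreover have "continuous_on K (\<lambda>x. dot x (app x))"
    unfolding app_def
    by (intro continuous_dot continuous_on_sum continuous_on_mult continuous_on_const
        continuous_on_product_coordinates[THEN continuous_on_subset] subset_UNIV)
  ultimately obtain v where v: "v \<in> K" and max: "\<And>y. y \<in> K \<Longrightarrow> dot y (app y) \<le> dot v (app v)"
    using continuous_attains_sup[OF \<open>compact K\<close>] by blast
  define \<mu> where "\<mu> = dot v (app v)"
  have v1: "dot v v = 1" "\<And>k. k < m \<Longrightarrow> dot v (e k) = 0"
    using v by (auto simp: K_def)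
  have le: "dot y (app y) \<le> \<mu> * dot y y" if y: "\<And>k. k < m \<Longrightarrow> dot y (e k) = 0" for y
  proof (cases "dot y y = 0")
    case True
    then have "dot y (app y) = 0" unfolding dot_self_eq_0 by (simp add: dot_def)
    then show ?thesis using True by simp
  next
    case False
    then have pos: "0 < dot y y" using dot_self_nonneg[of y] by simp
    define c where "c = 1 / sqrt (dot y y)"
    have cc: "c * c = 1 / dot y y"
      using pos by (simp add: c_def)
    define z where "z = (\<lambda>j. c * y j)"
    have "dot z z = 1" "\<forall>k<m. dot z (e k) = 0"
      using pos y by (simp_all add: z_def dot_simps cc flip: mult.assoc)
    from max[OF in_K[OF this]]
    have "dot z (app z) \<le> \<mu>"
      by (simp add: \<mu>_def dot_def app_def)
    moreover have "dot z (app z) = dot y (app y) / dot y y"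
      by (simp add: z_def app_simps dot_simps cc flip: mult.assoc)
    ultimately show ?thesis
      using pos by (simp add: field_simps)
  qed
  \<comment> \<open>The residual of the eigenvalue equation. It is orthogonal to \<open>v\<close> by
    the choice of \<open>\<mu>\<close>, and to every \<open>e k\<close> since these are eigenvectors
    of a symmetric matrix, so \<open>v + t w\<close> is an admissible competitor of \<open>v\<close>
    for every t.\<close>
  define w where "w = (\<lambda>i. app v i - \<mu> * v i)"
  have wv: "dot w v = 0"
    using v1 by (simp add: w_def dot_simps \<mu>_def dot_commute)
  have we: "dot w (e k) = 0" if "k < m" for k
  proof -
    have "dot (app v) (e k) = dot v (\<lambda>i. l k * e k i)"
      unfolding dot_app_commute using eig[OF that] by (simp add: dot_def)
    then show ?thesis using v1 that by (simp add: w_def dot_simps)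
  qed
  have wa: "dot w (app v) = dot w w"
  proof -
    have "dot w (\<lambda>i. app v i - \<mu> * v i) = dot w (app v)"
      by (simp only: dot_simps wv)
    then show ?thesis by (simp add: w_def)
  qed
  \<comment> \<open>Maximality along \<open>v + t w\<close>: the gain is linear in \<open>t\<close>
    and the loss quadratic, which for small positive \<open>t\<close> is possible only if
    \<open>w\<close> vanishes.\<close>
  have ineq: "2 * t * dot w w \<le> t\<^sup>2 * (\<mu> * dot w w - dot w (app w))" for t
  proof -
    have "dot (\<lambda>i. v i + t * w i) (e k) = 0" if "k < m" for k
      using that v1 we by (simp add: dot_simps)
    then have "dot (\<lambda>i. v i + t * w i) (app (\<lambda>i. v i + t * w i))
        \<le> \<mu> * dot (\<lambda>i. v i + t * w i) (\<lambda>i. v i + t * w i)"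
      by (rule le)
    also have "dot (\<lambda>i. v i + t * w i) (app (\<lambda>i. v i + t * w i))
        = \<mu> + 2 * t * dot w w + t\<^sup>2 * dot w (app w)"
    proof -
      have "dot v (app w) = dot w w"
        using wa by (simp only: dot_app_commute[symmetric] dot_commute[of "app v"])
      then show ?thesis
        by (simp only: dot_simps app_simps wa \<mu>_def[symmetric]) (simp add: power2_eq_square algebra_simps)
    qed
    also have "dot (\<lambda>i. v i + t * w i) (\<lambda>i. v i + t * w i) = 1 + t\<^sup>2 * dot w w"
      using wv dot_commute[of v w] v1 by (simp only: dot_simps) (simp add: power2_eq_square)
    finally show ?thesis
      by (simp add: algebra_simps)
  qed
  have "dot w w = 0"
  proof (rule ccontr)
    assume "dot w w \<noteq> 0"
    then have pos: "0 < dot w w" using dot_self_nonneg[of w] by simp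
    \<comment> \<open>With the \<open>t\<close> below one has \<open>t * D = dot w w\<close>,
      whereas the inequality demands at least twice as much; the summand 1 keeps \<open>D\<close>
      positive.\<close>
    define D where "D = \<bar>\<mu> * dot w w - dot w (app w)\<bar> + 1"
    define t where "t = dot w w / D"
    have D: "0 < D" by (simp add: D_def)
    then have t: "0 < t" using pos by (simp add: t_def)
    have "2 * t * dot w w \<le> t\<^sup>2 * D"
      by (rule order_trans[OF ineq mult_left_mono]) (auto simp: D_def)
    then have "2 * dot w w \<le> t * D"
      using t by (simp add: power2_eq_square)
    then show False using pos D by (simp add: t_def)
  qed
  then have "\<forall>i<N. app v i = \<mu> * v i"
    unfolding dot_self_eq_0 by (simp add: w_def)
  then show ?thesis using v1 by blast
qed

private lemma orthonormal_eigenvectors: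
  "m \<le> N \<Longrightarrow> \<exists>e l. (\<forall>k<m. \<forall>j<m. dot (e k) (e j) = (if k = j then 1 else 0))
     \<and> (\<forall>k<m. \<forall>i<N. app (e k) i = l k * e k i)"
proof (induction m)
  case 0
  then show ?case by simp
next
  case (Suc m)
  from Suc.IH[OF Suc_leD[OF Suc.prems]] obtain e l
    where orth: "\<forall>k<m. \<forall>j<m. dot (e k) (e j) = (if k = j then 1 else 0)"
      and eig: "\<forall>k<m. \<forall>i<N. app (e k) i = l k * e k i"
    by (elim exE conjE)
  have "\<exists>v \<mu>. dot v v = 1 \<and> (\<forall>k<m. dot v (e k) = 0) \<and> (\<forall>i<N. app v i = \<mu> * v i)"
    by (rule next_eigenvector[where l = l]) (use orth eig Suc.prems in simp_all)
  then obtain v \<mu> where v: "dot v v = 1" "\<forall>k<m. dot v (e k) = 0" "\<forall>i<N. app v i = \<mu> * v i"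
    by (elim exE conjE)
  have v4: "\<forall>k<m. dot (e k) v = 0"
    using v(2) by (simp add: dot_commute)
  have "dot ((e(m := v)) k) ((e(m := v)) j) = (if k = j then 1 else 0)" if "k < Suc m" "j < Suc m" for k j
    using v(1,2) v4 orth that by (cases "k = m"; cases "j = m") simp_all
  moreover have "app ((e(m := v)) k) i = (l(m := \<mu>)) k * (e(m := v)) k i" if "k < Suc m" "i < N" for k i
    using v(3) eig that by (cases "k = m") simp_all
  ultimately show ?case
    by (intro exI[of _ "e(m := v)"] exI[of _ "l(m := \<mu>)"] conjI allI impI)
qed

text \<open>Completeness of the eigenvectors is not part of the induction: the residuals of the N
  unit vectors have nonnegative squared lengths with total \<open>N - N = 0\<close>, so each of them
  vanishes.\<close>

theorem symmetric_matrix_spectral: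
  "\<exists>e l. (\<forall>k<N. \<forall>j<N. (\<Sum>i<N. e k i * e j i) = (if k = j then 1 else 0))
     \<and> (\<forall>i<N. \<forall>j<N. (\<Sum>k<N. e k i * e k j) = (if i = j then 1 else 0))
     \<and> (\<forall>k<N. \<forall>i<N. (\<Sum>j<N. A i j * e k j) = l k * (e k i :: real))"
proof -
  from orthonormal_eigenvectors[OF order_refl] obtain e l
    where orth': "\<forall>k<N. \<forall>j<N. dot (e k) (e j) = (if k = j then 1 else 0)"
      and eig: "\<forall>k<N. \<forall>i<N. app (e k) i = l k * e k i"
    by (elim exE conjE)
  note orth = orth'[rule_format]
  define x where "x i j = (if j = i then 1 else 0) - (\<Sum>k<N. e k i * e k j)" for i j
  have "dot (x i) (x i) = 0" if i: "i < N" for i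
  proof -
    have r: "dot (x i) (x i) = 1 - (\<Sum>k<N. (e k i)\<^sup>2)" if "i < N" for i
      unfolding x_def using orthonormal_residual(1)[OF orth that] by blast
    have "(\<Sum>i<N. dot (x i) (x i)) = 0"
      using sum_orthonormal_squares[OF orth, where m = N] r by simp
    then show ?thesis
      using i by (subst (asm) sum_nonneg_eq_0_iff) (auto intro: dot_self_nonneg)
  qed
  then have "x i j = 0" if "i < N" "j < N" for i j
    using that unfolding dot_self_eq_0 by blast
  then have "(\<Sum>k<N. e k i * e k j) = (if i = j then 1 else 0)" if "i < N" "j < N" for i j
    using that by (simp add: x_def eq_commute[of i j])
  then show ?thesis
    using orth' eig unfolding dot_def app_def
    by (intro exI[of _ e] exI[of _ l] conjI) auto
qed

end

section \<open>Squares of jointly Gaussian variables\<close>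

lemma centered_normal_eq_distr:
  assumes "0 < v"
  shows "centered_normal v = distr std_normal_distribution borel (\<lambda>x. sqrt v * x)"
proof -
  interpret N: real_distribution std_normal_distribution by (rule real_dist_normal_dist)
  have "distributed std_normal_distribution lborel (\<lambda>x. x) std_normal_density"
    unfolding distributed_def by (auto intro!: distr_id2)
  from N.normal_density_affine[OF this, of "sqrt v" 0]
  have D': "distributed std_normal_distribution lborel (\<lambda>x. sqrt v * x) (normal_density 0 (sqrt v))"
    using assms by simp
  then have "centered_normal v = distr std_normal_distribution lborel (\<lambda>x. sqrt v * x)"
    by (simp add: distributed_def centered_normal_def)
  also have "\<dots> = distr std_normal_distribution borel (\<lambda>x. sqrt v * x)"
    by (rule distr_cong) auto
  finally show ?thesis .
qed

text \<open>Scaling a standard normal variable by \<open>sqrt s\<close> treats the point mass,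
  \<open>s = 0\<close>, and the density case alike; later \<open>s\<close> is an eigenvalue of a
  covariance matrix, which may be 0.\<close>

lemma gaussian_rv_distr:
  assumes M: "prob_space M" and Y: "gaussian_rv M Y" and mean: "prob_space.expectation M Y = 0"
    and var: "prob_space.expectation M (\<lambda>\<omega>. (Y \<omega>)\<^sup>2) = s"
  shows "distr M borel Y = distr std_normal_distribution borel (\<lambda>x. sqrt s * x)"
proof -
  interpret prob_space M by fact
  interpret N: real_distribution std_normal_distribution by (rule real_dist_normal_dist)
  have [measurable]: "Y \<in> borel_measurable M" using Y by (simp add: gaussian_rv_def)
  obtain \<mu> where "(AE \<omega> in M. Y \<omega> = \<mu>) \<or> (\<exists>\<sigma>>0. distributed M lborel Y (normal_density \<mu> \<sigma>))"
    using Y by (auto simp: gaussian_rv_def)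
  then show ?thesis
  proof
    assume AE: "AE \<omega> in M. Y \<omega> = \<mu>"
    then have "expectation Y = expectation (\<lambda>_. \<mu>)"
      by (intro integral_cong_AE) auto
    then have \<mu>: "\<mu> = 0" using mean by (simp add: prob_space)
    have "expectation (\<lambda>\<omega>. (Y \<omega>)\<^sup>2) = expectation (\<lambda>_. 0)"
      using AE \<mu> by (intro integral_cong_AE) auto
    then have "s = 0" using var by simp
    moreover have "distr M borel Y = distr M borel (\<lambda>_. 0)"
      using AE \<mu> by (intro distr_cong_AE) auto
    ultimately show ?thesis by (simp add: N.distr_const)
  next
    assume "\<exists>\<sigma>>0. distributed M lborel Y (normal_density \<mu> \<sigma>)"
    then obtain \<sigma> where \<sigma>: "0 < \<sigma>" and D: "distributed M lborel Y (normal_density \<mu> \<sigma>)" by blast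
    have \<mu>: "\<mu> = 0" using normal_distributed_expectation[OF \<sigma> D] mean by simp
    have "s = \<sigma>\<^sup>2"
      using normal_distributed_variance[OF \<sigma> D] mean var by simp
    then have s: "sqrt s = \<sigma>" using \<sigma> by simp
    have "distr M borel Y = distr M lborel Y"
      by (rule distr_cong) auto
    also have "\<dots> = centered_normal (\<sigma>\<^sup>2)"
      using D \<mu> \<sigma> by (simp add: distributed_def centered_normal_def)
    also have "\<dots> = distr std_normal_distribution borel (\<lambda>x. \<sigma> * x)"
      using \<sigma> by (simp add: centered_normal_eq_distr)
    finally show ?thesis by (simp add: s)
  qed
qed

lemma std_normal_iexp:
  "(LINT x|std_normal_distribution. iexp (w * x)) = complex_of_real (exp (- w\<^sup>2 / 2))"
  using char_std_normal_distribution by (simp add: char_def fun_eq_iff)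

lemma gaussian_rv_integral:
  fixes h :: "real \<Rightarrow> 'b :: {banach, second_countable_topology}"
  assumes "prob_space M" "gaussian_rv M Y" "prob_space.expectation M Y = 0"
    and "prob_space.expectation M (\<lambda>\<omega>. (Y \<omega>)\<^sup>2) = s"
    and [measurable]: "h \<in> borel_measurable borel"
  shows "(LINT \<omega>|M. h (Y \<omega>)) = (LINT x|std_normal_distribution. h (sqrt s * x))"
proof -
  have [measurable]: "Y \<in> borel_measurable M" using assms by (simp add: gaussian_rv_def)
  have "(LINT \<omega>|M. h (Y \<omega>)) = (LINT x|distr M borel Y. h x)"
    by (simp add: integral_distr)
  also have "\<dots> = (LINT x|std_normal_distribution. h (sqrt s * x))"
    unfolding gaussian_rv_distr[OF assms(1-4)] by (simp add: integral_distr)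
  finally show ?thesis .
qed

lemma gaussian_rv_char:
  assumes "prob_space M" "gaussian_rv M Y" "prob_space.expectation M Y = 0"
    and "prob_space.expectation M (\<lambda>\<omega>. (Y \<omega>)\<^sup>2) = s"
  shows "(LINT \<omega>|M. iexp (Y \<omega>)) = complex_of_real (exp (- s / 2))"
proof -
  have "0 \<le> s" using assms(4) by (auto intro: integral_nonneg_AE)
  then show ?thesis
    using gaussian_rv_integral[OF assms, of iexp] std_normal_iexp[of "sqrt s"] by simp
qed

section \<open>From phases in Y to phases in the square of Y, and the product formula\<close>

context prob_space
begin

lemma fourier_zero_imp_exp_zero:
  fixes V :: "'a \<Rightarrow> complex"
  assumes [measurable]: "V \<in> borel_measurable M" "Y \<in> borel_measurable M"
    and bnd: "\<And>\<omega>. norm (V \<omega>) \<le> C"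
    and zero: "\<And>w. (LINT \<omega>|M. V \<omega> * iexp (w * Y \<omega>)) = 0"
    and k: "0 \<le> k"
  shows "(LINT \<omega>|M. V \<omega> * complex_of_real (exp (- (k * (Y \<omega>)\<^sup>2)))) = 0"
proof -
  interpret N: real_distribution std_normal_distribution by (rule real_dist_normal_dist)
  interpret P: pair_prob_space M std_normal_distribution ..
  \<comment> \<open>The characteristic function of the standard normal law at \<open>c * y\<close>
    is \<open>exp (- (k * y\<^sup>2))\<close> for this \<open>c\<close>.\<close>
  define c where "c = sqrt (2 * k)"
  have e: "complex_of_real (exp (- (k * y\<^sup>2))) = (LINT x|std_normal_distribution. iexp (c * x * y))" for y
  proof -
    have "(c * y)\<^sup>2 / 2 = k * y\<^sup>2" using k by (simp add: c_def power_mult_distrib)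
    then show ?thesis using std_normal_iexp[of "c * y"] by (simp add: mult_ac)
  qed
  have "(LINT \<omega>|M. V \<omega> * complex_of_real (exp (- (k * (Y \<omega>)\<^sup>2))))
      = (LINT \<omega>|M. LINT x|std_normal_distribution. V \<omega> * iexp (c * x * Y \<omega>))"
    by (simp only: e integral_mult_right_zero)
  also have "\<dots> = (LINT x|std_normal_distribution. LINT \<omega>|M. V \<omega> * iexp (c * x * Y \<omega>))"
  proof (rule P.Fubini_integral[symmetric])
    show "integrable (M \<Otimes>\<^sub>M std_normal_distribution) (\<lambda>(\<omega>, x). V \<omega> * iexp (c * x * Y \<omega>))"
      using bnd by (intro P.integrable_const_bound[of _ C]) (auto simp: norm_mult)
  qed
  also have "\<dots> = 0"
    by (simp only: zero) simp
  finally show ?thesis .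
qed

lemma fourier_zero_imp_comp_zero_real:
  fixes V :: "'a \<Rightarrow> complex" and h :: "real \<Rightarrow> real"
  assumes [measurable]: "V \<in> borel_measurable M" "Y \<in> borel_measurable M"
    and bnd: "\<And>\<omega>. norm (V \<omega>) \<le> C"
    and zero: "\<And>w. (LINT \<omega>|M. V \<omega> * iexp (w * Y \<omega>)) = 0"
    and k: "0 \<le> k"
    and h: "continuous_on {0..1} h" and [measurable]: "h \<in> borel_measurable borel"
  shows "(LINT \<omega>|M. V \<omega> * complex_of_real (h (exp (- (k * (Y \<omega>)\<^sup>2))))) = 0" (is "?I = 0")
proof -
  have C: "0 \<le> C" using bnd[of undefined] norm_ge_zero by (rule order_trans[rotated])
  define E where "E \<omega> = exp (- (k * (Y \<omega>)\<^sup>2))" for \<omega>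
  have [measurable]: "E \<in> borel_measurable M" unfolding E_def by measurable
  have E: "E \<omega> \<in> {0..1}" for \<omega> using k by (simp add: E_def)
  have "norm ?I \<le> C * e" if e: "0 < e" for e
  proof -
    obtain g where "real_polynomial_function g" and g: "\<And>x. x \<in> {0..1} \<Longrightarrow> \<bar>h x - g x\<bar> < e"
      using Stone_Weierstrass_real_polynomial_function[OF compact_Icc h e] by blast
    then obtain a n where g_eq: "g = (\<lambda>x. \<Sum>i\<le>n. a i * x ^ i)"
      by (auto simp: real_polynomial_function_iff_sum)
    have [measurable]: "g \<in> borel_measurable borel" unfolding g_eq by measurable
    have int_pow: "integrable M (\<lambda>\<omega>. V \<omega> * complex_of_real (E \<omega> ^ i))" for i
    proof (rule integrable_const_bound[of _ C])
      have "norm (V \<omega>) * E \<omega> ^ i \<le> C * 1" for \<omega>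
        using bnd[of \<omega>] E[of \<omega>] C by (intro mult_mono) (auto intro: power_le_one)
      then show "AE \<omega> in M. norm (V \<omega> * complex_of_real (E \<omega> ^ i)) \<le> C"
        using E by (auto simp: norm_mult norm_power)
    qed simp
    \<comment> \<open>Powers of \<open>E\<close> are again of the form
      \<open>exp (- (k * y\<^sup>2))\<close>, with \<open>i * k\<close> in place of
      \<open>k\<close>; \<open>i = 0\<close> is the reason for admitting \<open>k = 0\<close> in the
      preceding lemma.\<close>
    have pow: "(LINT \<omega>|M. V \<omega> * complex_of_real (E \<omega> ^ i)) = 0" for i
    proof -
      have "E \<omega> ^ i = exp (- ((real i * k) * (Y \<omega>)\<^sup>2))" for \<omega>
        by (simp add: E_def exp_of_nat_mult[symmetric] mult.assoc)
      then show ?thesis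
        using fourier_zero_imp_exp_zero[OF assms(1-2) bnd zero, of "real i * k"] k by simp
    qed
    have gs: "V \<omega> * complex_of_real (g (E \<omega>)) = (\<Sum>i\<le>n. complex_of_real (a i) * (V \<omega> * complex_of_real (E \<omega> ^ i)))" for \<omega>
      by (simp add: g_eq sum_distrib_left mult_ac)
    have int_g: "integrable M (\<lambda>\<omega>. V \<omega> * complex_of_real (g (E \<omega>)))"
      unfolding gs using int_pow by (intro Bochner_Integration.integrable_sum integrable_mult_right) auto
    have g0: "(LINT \<omega>|M. V \<omega> * complex_of_real (g (E \<omega>))) = 0"
      unfolding gs using int_pow pow
      by (subst Bochner_Integration.integral_sum) (auto intro!: integrable_mult_right simp del: of_real_power)
    have diff_bnd: "norm (V \<omega> * complex_of_real (h (E \<omega>) - g (E \<omega>))) \<le> C * e" for \<omega>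
      unfolding norm_mult using bnd[of \<omega>] g[OF E, of \<omega>] C by (intro mult_mono) (auto simp del: of_real_diff)
    have int_d: "integrable M (\<lambda>\<omega>. V \<omega> * complex_of_real (h (E \<omega>) - g (E \<omega>)))"
      by (rule integrable_const_bound[of _ "C * e"]) (use diff_bnd in \<open>auto simp del: of_real_diff\<close>)
    have "?I = (LINT \<omega>|M. V \<omega> * complex_of_real (g (E \<omega>)) + V \<omega> * complex_of_real (h (E \<omega>) - g (E \<omega>)))"
      by (simp add: algebra_simps E_def)
    also have "\<dots> = (LINT \<omega>|M. V \<omega> * complex_of_real (h (E \<omega>) - g (E \<omega>)))"
      using int_g int_d g0
      by (subst Bochner_Integration.integral_add) (simp_all del: of_real_diff)
    also have "norm \<dots> \<le> (LINT \<omega>|M. norm (V \<omega> * complex_of_real (h (E \<omega>) - g (E \<omega>))))"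
      by (rule integral_norm_bound)
    also have "\<dots> \<le> (LINT \<omega>|M. C * e)"
      using int_d diff_bnd by (intro integral_mono integrable_norm) auto
    finally show ?thesis by (simp add: prob_space)
  qed
  note le = this
  have "norm ?I \<le> 0"
  proof (rule field_le_epsilon)
    fix e :: real assume e: "0 < e"
    then have "0 < e / (C + 1)" using C by simp
    from le[OF this] have "norm ?I \<le> C * (e / (C + 1))" .
    also have "\<dots> \<le> e" using C e by (simp add: divide_le_eq algebra_simps)
    finally show "norm ?I \<le> 0 + e" by simp
  qed
  then show ?thesis by simp
qed

text \<open>With \<open>y = exp (- (k * Y\<^sup>2))\<close> a phase in \<open>Y\<^sup>2\<close>
  becomes a phase in \<open>ln y\<close>, which has no limit at 0. The factor \<open>y\<close> damps
  it there, so that polynomial approximation on the closed interval applies.\<close>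

lemma continuous_on_times_iexp_ln:
  "continuous_on {0..1} (\<lambda>y. complex_of_real y * iexp (c * ln y))"
  unfolding continuous_on_eq_continuous_within
proof
  fix y :: real assume "y \<in> {0..1}"
  show "continuous (at y within {0..1}) (\<lambda>y. complex_of_real y * iexp (c * ln y))"
  proof (cases "y = 0")
    case True
    have "((\<lambda>y. complex_of_real y * iexp (c * ln y)) \<longlongrightarrow> 0) (at 0 within {0..1})"
    proof (rule Lim_null_comparison)
      show "((\<lambda>y. \<bar>y\<bar>) \<longlongrightarrow> (0::real)) (at 0 within {0..1})"
        by (rule tendsto_eq_intros refl | simp)+
    qed (simp add: norm_mult)
    then show ?thesis using True by (simp add: continuous_within)
  next
    case False
    then have "isCont (\<lambda>y. complex_of_real y * iexp (c * ln y)) y"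
      by (intro continuous_intros) auto
    then show ?thesis by (rule continuous_at_imp_continuous_at_within)
  qed
qed

lemma fourier_zero_imp_iexp_square_zero:
  fixes V :: "'a \<Rightarrow> complex"
  assumes [measurable]: "V \<in> borel_measurable M" "Y \<in> borel_measurable M"
    and bnd: "\<And>\<omega>. norm (V \<omega>) \<le> C"
    and zero: "\<And>w. (LINT \<omega>|M. V \<omega> * iexp (w * Y \<omega>)) = 0"
  shows "(LINT \<omega>|M. V \<omega> * iexp (t * (Y \<omega>)\<^sup>2)) = 0"
proof -
  have damped: "(LINT \<omega>|M. V \<omega> * (complex_of_real (exp (- (k * (Y \<omega>)\<^sup>2))) * iexp (t * (Y \<omega>)\<^sup>2))) = 0"
    if k: "0 < k" for k
  proof -
    \<comment> \<open>The factor \<open>- (t / k)\<close> turns \<open>ln (E \<omega>)\<close>,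
      which is \<open>- (k * (Y \<omega>)\<^sup>2)\<close>, into the phase
      \<open>t * (Y \<omega>)\<^sup>2\<close>.\<close>
    define h where "h y = complex_of_real y * iexp (- (t / k) * ln y)" for y
    have cont: "continuous_on {0..1} h"
      unfolding h_def by (rule continuous_on_times_iexp_ln)
    have [measurable]: "h \<in> borel_measurable borel" unfolding h_def by measurable
    define E where "E \<omega> = exp (- (k * (Y \<omega>)\<^sup>2))" for \<omega>
    have [measurable]: "E \<in> borel_measurable M" unfolding E_def by measurable
    have E: "E \<omega> \<in> {0..1}" for \<omega> using k by (simp add: E_def)
    have hE: "h (E \<omega>) = complex_of_real (exp (- (k * (Y \<omega>)\<^sup>2))) * iexp (t * (Y \<omega>)\<^sup>2)" for \<omega>
      using k by (simp add: h_def E_def)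
    have nh: "norm (h (E \<omega>)) \<le> 1" for \<omega>
      using E[of \<omega>] by (simp add: h_def norm_mult)
    have int: "integrable M (\<lambda>\<omega>. V \<omega> * complex_of_real (u (E \<omega>)))"
      if "u = (\<lambda>x. Re (h x)) \<or> u = (\<lambda>x. Im (h x))" for u
    proof (rule integrable_const_bound[of _ C])
      have "\<bar>u (E \<omega>)\<bar> \<le> 1" for \<omega>
        using that nh[of \<omega>] abs_Re_le_cmod[of "h (E \<omega>)"] abs_Im_le_cmod[of "h (E \<omega>)"] by auto
      then have "norm (V \<omega>) * \<bar>u (E \<omega>)\<bar> \<le> C * 1" for \<omega>
        using bnd[of \<omega>] by (intro mult_mono) (auto intro: order_trans[OF norm_ge_zero])
      then show "AE \<omega> in M. norm (V \<omega> * complex_of_real (u (E \<omega>))) \<le> C"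
        by (auto simp: norm_mult)
    qed (use that in auto)
    have z: "(LINT \<omega>|M. V \<omega> * complex_of_real (Re (h (E \<omega>)))) = 0"
      "(LINT \<omega>|M. V \<omega> * complex_of_real (Im (h (E \<omega>)))) = 0"
      unfolding E_def using k cont
      by (intro fourier_zero_imp_comp_zero_real[OF assms(1-2) bnd zero, of _ "\<lambda>x. Re (h x)"]
           fourier_zero_imp_comp_zero_real[OF assms(1-2) bnd zero, of _ "\<lambda>x. Im (h x)"];
         auto intro!: continuous_intros)+
    have "(LINT \<omega>|M. V \<omega> * h (E \<omega>)) = (LINT \<omega>|M. V \<omega> * complex_of_real (Re (h (E \<omega>)))
        + \<i> * (V \<omega> * complex_of_real (Im (h (E \<omega>)))))"
    proof (intro Bochner_Integration.integral_cong refl)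
      fix \<omega>
      have "V \<omega> * h (E \<omega>) = V \<omega> * (complex_of_real (Re (h (E \<omega>))) + \<i> * complex_of_real (Im (h (E \<omega>))))"
        by (simp only: complex_eq[symmetric])
      then show "V \<omega> * h (E \<omega>) = V \<omega> * complex_of_real (Re (h (E \<omega>)))
        + \<i> * (V \<omega> * complex_of_real (Im (h (E \<omega>))))" by (simp add: algebra_simps)
    qed
    also have "\<dots> = 0"
      using int z by (subst Bochner_Integration.integral_add) (auto intro!: integrable_mult_right)
    finally show ?thesis unfolding hE .
  qed
  \<comment> \<open>The damping is removed along \<open>k = 1 / Suc m\<close>; the constant
    \<open>C\<close> dominates.\<close>
  define F where "F m \<omega> = V \<omega> * (complex_of_real (exp (- ((1 / real (Suc m)) * (Y \<omega>)\<^sup>2))) * iexp (t * (Y \<omega>)\<^sup>2))" for m \<omega>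
  have "(\<lambda>m. LINT \<omega>|M. F m \<omega>) \<longlonglongrightarrow> (LINT \<omega>|M. V \<omega> * iexp (t * (Y \<omega>)\<^sup>2))"
  proof (rule integral_dominated_convergence[where w = "\<lambda>_. C"])
    show "AE \<omega> in M. (\<lambda>m. F m \<omega>) \<longlonglongrightarrow> V \<omega> * iexp (t * (Y \<omega>)\<^sup>2)"
    proof (rule AE_I2)
      fix \<omega>
      have "(\<lambda>m. exp (- ((1 / real (Suc m)) * (Y \<omega>)\<^sup>2))) \<longlonglongrightarrow> exp (- (0 * (Y \<omega>)\<^sup>2))"
        by (intro tendsto_intros LIMSEQ_Suc[OF lim_1_over_n])
      then have "(\<lambda>m. F m \<omega>) \<longlonglongrightarrow> V \<omega> * (complex_of_real (exp (- (0 * (Y \<omega>)\<^sup>2))) * iexp (t * (Y \<omega>)\<^sup>2))"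
        unfolding F_def by (intro tendsto_mult tendsto_of_real tendsto_const)
      then show "(\<lambda>m. F m \<omega>) \<longlonglongrightarrow> V \<omega> * iexp (t * (Y \<omega>)\<^sup>2)" by simp
    qed
    show "AE \<omega> in M. norm (F m \<omega>) \<le> C" for m
    proof (rule AE_I2)
      fix \<omega>
      have "norm (V \<omega>) * exp (- ((1 / real (Suc m)) * (Y \<omega>)\<^sup>2)) \<le> C * 1"
        using bnd[of \<omega>] by (intro mult_mono) (auto intro: order_trans[OF norm_ge_zero])
      then show "norm (F m \<omega>) \<le> C" by (simp add: F_def norm_mult)
    qed
  qed (auto simp: F_def)
  moreover have "(LINT \<omega>|M. F m \<omega>) = 0" for m
    unfolding F_def by (rule damped) simp
  ultimately show ?thesis
    by (simp add: LIMSEQ_const_iff)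
qed

text \<open>The coordinates are converted one by one. The inductive statement has squares in the
  first \<open>m\<close> places and linear phases, with arbitrary frequencies, in the others;
  freedom in the frequency of place \<open>m\<close> is exactly what the transfer from
  \<open>Y m\<close> to its square requires.\<close>

lemma char_sum_squares_eq_prod:
  fixes Y :: "nat \<Rightarrow> 'a \<Rightarrow> real"
  assumes [measurable]: "\<And>k. Y k \<in> borel_measurable M"
    and indep: "\<And>\<theta>. (LINT \<omega>|M. iexp (\<Sum>k<N. \<theta> k * Y k \<omega>)) = (\<Prod>k<N. LINT \<omega>|M. iexp (\<theta> k * Y k \<omega>))"
  shows "(LINT \<omega>|M. iexp (t * (\<Sum>k<N. (Y k \<omega>)\<^sup>2))) = (\<Prod>k<N. LINT \<omega>|M. iexp (t * (Y k \<omega>)\<^sup>2))"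
proof -
  have "(LINT \<omega>|M. iexp (t * (\<Sum>k<m. (Y k \<omega>)\<^sup>2)) * iexp (\<Sum>k=m..<N. \<theta> k * Y k \<omega>))
      = (\<Prod>k<m. LINT \<omega>|M. iexp (t * (Y k \<omega>)\<^sup>2)) * (\<Prod>k=m..<N. LINT \<omega>|M. iexp (\<theta> k * Y k \<omega>))"
    if "m \<le> N" for m \<theta>
    using that
  proof (induction m arbitrary: \<theta>)
    case 0
    then show ?case using indep[of \<theta>] by (simp add: lessThan_atLeast0 del: of_real_sum of_real_mult)
  next
    case (Suc m)
    define W where "W \<omega> = iexp (t * (\<Sum>k<m. (Y k \<omega>)\<^sup>2)) * iexp (\<Sum>k=Suc m..<N. \<theta> k * Y k \<omega>)" for \<omega>
    define c where "c = (\<Prod>k<m. LINT \<omega>|M. iexp (t * (Y k \<omega>)\<^sup>2)) * (\<Prod>k=Suc m..<N. LINT \<omega>|M. iexp (\<theta> k * Y k \<omega>))"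
    have [measurable]: "W \<in> borel_measurable M" unfolding W_def by measurable
    have W1: "norm (W \<omega>) = 1" for \<omega> by (simp add: W_def norm_mult del: of_real_sum of_real_mult)
    have split: "{m..<N} = insert m {Suc m..<N}" using Suc.prems by auto
    have int: "integrable M (\<lambda>\<omega>. W \<omega> * iexp (u \<omega>))" "integrable M (\<lambda>\<omega>. iexp (u \<omega>))"
      if [measurable]: "u \<in> borel_measurable M" for u
      by (intro integrable_const_bound[of _ 1]; simp add: norm_mult W1)+
    have eq: "(LINT \<omega>|M. W \<omega> * iexp (w * Y m \<omega>)) = c * (LINT \<omega>|M. iexp (w * Y m \<omega>))" for w
    proof -
      have "(\<Sum>k=m..<N. (\<theta>(m := w)) k * Y k \<omega>) = w * Y m \<omega> + (\<Sum>k=Suc m..<N. \<theta> k * Y k \<omega>)" for \<omega>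
        unfolding split by (subst sum.insert) (auto intro!: sum.cong)
      moreover have "(\<Prod>k=m..<N. LINT \<omega>|M. iexp ((\<theta>(m := w)) k * Y k \<omega>))
          = (LINT \<omega>|M. iexp (w * Y m \<omega>)) * (\<Prod>k=Suc m..<N. LINT \<omega>|M. iexp (\<theta> k * Y k \<omega>))"
        unfolding split by (subst prod.insert) (auto intro!: prod.cong)
      ultimately show ?thesis
        using Suc.IH[of "\<theta>(m := w)"] Suc.prems
        by (simp add: W_def c_def exp_add distrib_left mult_ac del: of_real_sum of_real_mult fun_upd_apply)
    qed
    \<comment> \<open>Subtracting the constant \<open>c\<close> turns a product formula into the
      vanishing of a Fourier transform, for the bounded variable \<open>V = W - c\<close>.\<close>
    have "(LINT \<omega>|M. (W \<omega> - c) * iexp (w * Y m \<omega>)) = 0" for w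
      using eq[of w] int[of "\<lambda>\<omega>. w * Y m \<omega>"]
      by (simp add: left_diff_distrib Bochner_Integration.integral_diff del: of_real_mult)
    moreover have "norm (W \<omega> - c) \<le> 1 + norm c" for \<omega>
      using norm_triangle_ineq4[of "W \<omega>" c] W1 by simp
    ultimately have "(LINT \<omega>|M. (W \<omega> - c) * iexp (t * (Y m \<omega>)\<^sup>2)) = 0"
      by (intro fourier_zero_imp_iexp_square_zero[where C = "1 + norm c"]) auto
    then have "(LINT \<omega>|M. W \<omega> * iexp (t * (Y m \<omega>)\<^sup>2)) = c * (LINT \<omega>|M. iexp (t * (Y m \<omega>)\<^sup>2))"
      using int[of "\<lambda>\<omega>. t * (Y m \<omega>)\<^sup>2"]
      by (simp add: left_diff_distrib Bochner_Integration.integral_diff del: of_real_mult)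
    then show ?case
      by (simp add: W_def c_def exp_add distrib_left mult_ac del: of_real_sum of_real_mult)
  qed
  from this[of N "\<lambda>_. 0"] show ?thesis by simp
qed

end

section \<open>Diagonalisation of a Gaussian vector\<close>

lemma spectral_parseval:
  fixes e :: "nat \<Rightarrow> nat \<Rightarrow> real"
  assumes compl: "\<And>i j. i < N \<Longrightarrow> j < N \<Longrightarrow> (\<Sum>k<N. e k i * e k j) = (if i = j then 1 else 0)"
  shows "(\<Sum>k<N. (\<Sum>i<N. x i * e k i) * (\<Sum>i<N. y i * e k i)) = (\<Sum>i<N. x i * y i)"
proof -
  have "(\<Sum>k<N. (\<Sum>i<N. x i * e k i) * (\<Sum>i<N. y i * e k i))
      = (\<Sum>k<N. \<Sum>i<N. \<Sum>j<N. x i * y j * (e k i * e k j))"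
    by (simp add: sum_product mult_ac)
  also have "\<dots> = (\<Sum>i<N. \<Sum>k<N. \<Sum>j<N. x i * y j * (e k i * e k j))"
    by (rule sum.swap)
  also have "\<dots> = (\<Sum>i<N. \<Sum>j<N. \<Sum>k<N. x i * y j * (e k i * e k j))"
    by (intro sum.cong refl sum.swap)
  also have "\<dots> = (\<Sum>i<N. \<Sum>j<N. if j = i then x i * y j else 0)"
    unfolding sum_distrib_left[symmetric] using compl by (intro sum.cong refl) auto
  also have "\<dots> = (\<Sum>i<N. x i * y i)"
    by (intro sum.cong refl) simp
  finally show ?thesis .
qed

text \<open>Each \<open>l k\<close>, or its square, is weighted with the squared length 1 of
  \<open>e k\<close>; the eigenvalue equation replaces \<open>l k * e k i\<close> by row
  \<open>i\<close> of \<open>A\<close> against \<open>e k\<close>, and Parseval pairs that row with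
  the \<open>i\<close>-th unit vector or with itself.\<close>

lemma symmetric_matrix_eigenvalue_sums:
  fixes A :: "nat \<Rightarrow> nat \<Rightarrow> real"
  assumes compl: "\<And>i j. i < N \<Longrightarrow> j < N \<Longrightarrow> (\<Sum>k<N. e k i * e k j) = (if i = j then 1 else 0)"
    and orth: "\<And>k j. k < N \<Longrightarrow> j < N \<Longrightarrow> (\<Sum>i<N. e k i * e j i) = (if k = j then 1 else 0)"
    and eig: "\<And>k i. k < N \<Longrightarrow> i < N \<Longrightarrow> (\<Sum>j<N. A i j * e k j) = l k * e k i"
  shows "(\<Sum>k<N. l k) = (\<Sum>i<N. A i i)" and "(\<Sum>k<N. (l k)\<^sup>2) = (\<Sum>i<N. \<Sum>j<N. (A i j)\<^sup>2)"
proof -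
  have d: "(\<Sum>j<N. (if j = i then 1 else 0) * z j) = z i" if "i < N" for i and z :: "nat \<Rightarrow> real"
  proof -
    have "(\<Sum>j<N. (if j = i then 1 else 0) * z j) = (\<Sum>j<N. if j = i then z j else 0)"
      by (intro sum.cong) auto
    then show ?thesis using that by simp
  qed
  have "(\<Sum>k<N. l k) = (\<Sum>k<N. \<Sum>i<N. (l k * e k i) * e k i)"
    by (intro sum.cong refl) (simp add: orth mult.assoc sum_distrib_left[symmetric])
  also have "\<dots> = (\<Sum>i<N. \<Sum>k<N. (l k * e k i) * e k i)"
    by (rule sum.swap)
  also have "\<dots> = (\<Sum>i<N. \<Sum>k<N. (\<Sum>j<N. A i j * e k j) * (\<Sum>j<N. (if j = i then 1 else 0) * e k j))"
    by (intro sum.cong refl) (simp only: d eig lessThan_iff)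
  also have "\<dots> = (\<Sum>i<N. \<Sum>j<N. A i j * (if j = i then 1 else 0))"
    by (simp only: spectral_parseval[OF compl])
  also have "\<dots> = (\<Sum>i<N. A i i)"
    using d[of _ "A _"] by (intro sum.cong refl) (simp add: mult.commute)
  finally show "(\<Sum>k<N. l k) = (\<Sum>i<N. A i i)" .
  have "(\<Sum>k<N. (l k)\<^sup>2) = (\<Sum>k<N. \<Sum>i<N. (l k * e k i) * (l k * e k i))"
  proof (intro sum.cong refl)
    fix k assume "k \<in> {..<N}"
    then have "(l k)\<^sup>2 = (l k)\<^sup>2 * (\<Sum>i<N. e k i * e k i)" by (simp add: orth)
    also have "\<dots> = (\<Sum>i<N. (l k * e k i) * (l k * e k i))"
      unfolding sum_distrib_left by (simp add: power2_eq_square mult_ac)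
    finally show "(l k)\<^sup>2 = (\<Sum>i<N. (l k * e k i) * (l k * e k i))" .
  qed
  also have "\<dots> = (\<Sum>i<N. \<Sum>k<N. (l k * e k i) * (l k * e k i))"
    by (rule sum.swap)
  also have "\<dots> = (\<Sum>i<N. \<Sum>k<N. (\<Sum>j<N. A i j * e k j) * (\<Sum>j<N. A i j * e k j))"
    by (intro sum.cong refl) (simp only: eig lessThan_iff)
  also have "\<dots> = (\<Sum>i<N. \<Sum>j<N. (A i j)\<^sup>2)"
    by (simp only: spectral_parseval[OF compl] power2_eq_square)
  finally show "(\<Sum>k<N. (l k)\<^sup>2) = (\<Sum>i<N. \<Sum>j<N. (A i j)\<^sup>2)" .
qed

text \<open>The eigenvalue equation is read at the coordinate where \<open>v\<close> has largest
  modulus, as in Gershgorin's theorem.\<close>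

lemma eigenvalue_le_row_sum:
  fixes A :: "nat \<Rightarrow> nat \<Rightarrow> real"
  assumes row: "\<And>i. i < N \<Longrightarrow> (\<Sum>j<N. \<bar>A i j\<bar>) \<le> R"
    and v: "(\<Sum>i<N. v i * v i) \<noteq> 0"
    and eig: "\<And>i. i < N \<Longrightarrow> (\<Sum>j<N. A i j * v j) = l * v i"
  shows "\<bar>l\<bar> \<le> R"
proof -
  have N: "{..<N} \<noteq> {}" using v by (metis sum.empty)
  obtain i where i: "i < N" and max: "\<And>j. j < N \<Longrightarrow> \<bar>v j\<bar> \<le> \<bar>v i\<bar>"
  proof -
    have "Max ((\<lambda>i. \<bar>v i\<bar>) ` {..<N}) \<in> (\<lambda>i. \<bar>v i\<bar>) ` {..<N}"
      using N by (intro Max_in) auto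
    then obtain i where "i < N" "Max ((\<lambda>i. \<bar>v i\<bar>) ` {..<N}) = \<bar>v i\<bar>" by auto
    moreover have "\<bar>v j\<bar> \<le> Max ((\<lambda>i. \<bar>v i\<bar>) ` {..<N})" if "j < N" for j
      using that by (intro Max_ge) auto
    ultimately show ?thesis using that by metis
  qed
  have pos: "0 < \<bar>v i\<bar>"
  proof (rule ccontr)
    assume "\<not> ?thesis"
    then have "\<forall>j<N. v j = 0" using max by force
    then show False using v by simp
  qed
  have "\<bar>l\<bar> * \<bar>v i\<bar> = \<bar>\<Sum>j<N. A i j * v j\<bar>"
    using eig[OF i] by (simp add: abs_mult)
  also have "\<dots> \<le> (\<Sum>j<N. \<bar>A i j\<bar> * \<bar>v i\<bar>)"
    by (rule order_trans[OF sum_abs]) (auto simp: abs_mult intro!: sum_mono mult_left_mono max)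
  also have "\<dots> \<le> R * \<bar>v i\<bar>"
    unfolding sum_distrib_right[symmetric] by (intro mult_right_mono row i) simp
  finally show ?thesis using pos by simp
qed

text \<open>In the eigenbasis the coordinates \<open>Y k\<close> are uncorrelated. A combination
  with frequencies \<open>\<theta>\<close> is a combination of the \<open>\<xi> j\<close>, hence
  Gaussian with variance the sum of \<open>(\<theta> k)\<^sup>2 * l k\<close>; its characteristic
  function splits into the factors that the product formula asks for. Eigenvalues are nonnegative as
  variances of the \<open>Y k\<close>, and Parseval turns the squares of the \<open>\<xi> j\<close>
  into those of the \<open>Y k\<close>.\<close>

lemma gaussian_square_sum_char:
  fixes \<xi> :: "nat \<Rightarrow> 'a \<Rightarrow> real" and \<Gamma> :: "nat \<Rightarrow> nat \<Rightarrow> real"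
  assumes M: "prob_space M"
    and gauss: "\<And>c. gaussian_rv M (\<lambda>\<omega>. \<Sum>j<N. c j * \<xi> j \<omega>)"
    and int: "\<And>j. integrable M (\<xi> j)" "\<And>i j. integrable M (\<lambda>\<omega>. \<xi> i \<omega> * \<xi> j \<omega>)"
    and mean: "\<And>j. prob_space.expectation M (\<xi> j) = 0"
    and cov: "\<And>i j. i < N \<Longrightarrow> j < N \<Longrightarrow> prob_space.expectation M (\<lambda>\<omega>. \<xi> i \<omega> * \<xi> j \<omega>) = \<Gamma> i j"
    and row: "\<And>i. i < N \<Longrightarrow> (\<Sum>j<N. \<bar>\<Gamma> i j\<bar>) \<le> R"
  shows "\<exists>l. (\<forall>k<N. 0 \<le> l k \<and> l k \<le> R) \<and> (\<Sum>k<N. l k) = (\<Sum>i<N. \<Gamma> i i)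
    \<and> (\<Sum>k<N. (l k)\<^sup>2) = (\<Sum>i<N. \<Sum>j<N. (\<Gamma> i j)\<^sup>2)
    \<and> (\<forall>t. (LINT \<omega>|M. iexp (t * (\<Sum>j<N. (\<xi> j \<omega>)\<^sup>2)))
        = (\<Prod>k<N. LINT x|std_normal_distribution. iexp (t * (l k * x\<^sup>2))))"
proof -
  interpret prob_space M by fact
  have [measurable]: "\<xi> j \<in> borel_measurable M" for j using int(1)[of j] by simp
  have sym: "\<Gamma> i j = \<Gamma> j i" if "i < N" "j < N" for i j
    using cov[of i j] cov[of j i] that by (simp add: mult.commute)
  have "\<exists>e l. (\<forall>k<N. \<forall>j<N. (\<Sum>i<N. e k i * e j i) = (if k = j then 1 else 0))
     \<and> (\<forall>i<N. \<forall>j<N. (\<Sum>k<N. e k i * e k j) = (if i = j then 1 else 0))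
     \<and> (\<forall>k<N. \<forall>i<N. (\<Sum>j<N. \<Gamma> i j * e k j) = l k * (e k i :: real))"
    by (rule symmetric_matrix_spectral) (rule sym)
  then obtain e l where
    orth': "\<forall>k<N. \<forall>j<N. (\<Sum>i<N. e k i * e j i) = (if k = j then 1 else 0)" and
    compl': "\<forall>i<N. \<forall>j<N. (\<Sum>k<N. e k i * e k j) = (if i = j then 1 else 0)" and
    eig': "\<forall>k<N. \<forall>i<N. (\<Sum>j<N. \<Gamma> i j * e k j) = l k * (e k i :: real)"
    by (elim exE conjE)
  note orth = orth'[rule_format] and compl = compl'[rule_format] and eig = eig'[rule_format]
  define S where "S c \<omega> = (\<Sum>j<N. c j * \<xi> j \<omega>)" for c \<omega>
  define Y where "Y k = S (e k)" for k
  have meanS: "expectation (S c) = 0" for c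
    unfolding S_def using int mean by (subst Bochner_Integration.integral_sum) auto
  have varS: "expectation (\<lambda>\<omega>. (S c \<omega>)\<^sup>2) = (\<Sum>i<N. \<Sum>j<N. c i * c j * \<Gamma> i j)" for c
  proof -
    have "expectation (\<lambda>\<omega>. (S c \<omega>)\<^sup>2) = expectation (\<lambda>\<omega>. \<Sum>i<N. \<Sum>j<N. c i * c j * (\<xi> i \<omega> * \<xi> j \<omega>))"
      by (simp add: S_def power2_eq_square sum_product mult_ac)
    also have "\<dots> = (\<Sum>i<N. \<Sum>j<N. c i * c j * expectation (\<lambda>\<omega>. \<xi> i \<omega> * \<xi> j \<omega>))"
      using int by (simp add: Bochner_Integration.integral_sum)
    finally show ?thesis by (simp add: cov)
  qed
  have quad: "(\<Sum>i<N. \<Sum>j<N. c i * c j * \<Gamma> i j) = (\<Sum>k<N. (\<theta> k)\<^sup>2 * l k)"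
    if c: "\<And>i. i < N \<Longrightarrow> c i = (\<Sum>k<N. \<theta> k * e k i)" for c \<theta>
  proof -
    have swap: "(\<Sum>j<N. \<Gamma> i j * (\<Sum>k<N. \<theta> k * e k j)) = (\<Sum>k<N. \<theta> k * (\<Sum>j<N. \<Gamma> i j * e k j))" for i
      unfolding sum_distrib_left by (subst sum.swap) (simp add: mult_ac)
    have "(\<Sum>i<N. \<Sum>j<N. c i * c j * \<Gamma> i j) = (\<Sum>i<N. c i * (\<Sum>j<N. \<Gamma> i j * (\<Sum>k<N. \<theta> k * e k j)))"
      by (simp add: sum_distrib_left mult_ac c)
    also have "\<dots> = (\<Sum>i<N. c i * (\<Sum>k<N. \<theta> k * (l k * e k i)))"
      unfolding swap by (simp add: eig)
    also have "\<dots> = (\<Sum>k<N. \<theta> k * l k * (\<Sum>i<N. c i * e k i))"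
      unfolding sum_distrib_left by (subst sum.swap) (simp add: mult_ac)
    also have "\<dots> = (\<Sum>k<N. (\<theta> k)\<^sup>2 * l k)"
    proof (intro sum.cong refl)
      fix k assume k: "k \<in> {..<N}"
      have "(\<Sum>i<N. c i * e k i) = (\<Sum>i<N. \<Sum>m<N. \<theta> m * (e m i * e k i))"
        by (simp add: c sum_distrib_left mult_ac)
      also have "\<dots> = (\<Sum>m<N. \<theta> m * (\<Sum>i<N. e m i * e k i))"
        unfolding sum_distrib_left by (rule sum.swap)
      also have "\<dots> = (\<Sum>m<N. if m = k then \<theta> m else 0)"
        using k by (intro sum.cong refl) (simp add: orth)
      finally show "\<theta> k * l k * (\<Sum>i<N. c i * e k i) = (\<theta> k)\<^sup>2 * l k"
        using k by (simp add: power2_eq_square)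
    qed
    finally show ?thesis .
  qed
  have char: "(LINT \<omega>|M. iexp (\<Sum>k<N. \<theta> k * Y k \<omega>)) = (\<Prod>k<N. complex_of_real (exp (- ((\<theta> k)\<^sup>2 * l k) / 2)))" for \<theta>
  proof -
    define c where "c i = (\<Sum>k<N. \<theta> k * e k i)" for i
    have "(\<Sum>k<N. \<theta> k * Y k \<omega>) = S c \<omega>" for \<omega>
      unfolding Y_def S_def c_def sum_distrib_left sum_distrib_right
      by (subst sum.swap) (simp add: mult_ac)
    then have "(LINT \<omega>|M. iexp (\<Sum>k<N. \<theta> k * Y k \<omega>)) = complex_of_real (exp (- (\<Sum>k<N. (\<theta> k)\<^sup>2 * l k) / 2))"
      using gaussian_rv_char[OF M _ meanS varS, of c] gauss[of c] quad[of c \<theta>]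
      by (simp add: S_def[abs_def] c_def)
    then show ?thesis
      by (simp add: exp_sum sum_divide_distrib flip: of_real_prod sum_negf)
  qed
  have char1: "(LINT \<omega>|M. iexp (\<theta> * Y k \<omega>)) = complex_of_real (exp (- (\<theta>\<^sup>2 * l k) / 2))" if "k < N" for \<theta> k
  proof -
    have "(\<Sum>j<N. (if j = k then \<theta> else 0) * Y j \<omega>) = (\<Sum>j<N. if j = k then \<theta> * Y j \<omega> else 0)" for \<omega>
      by (intro sum.cong) auto
    moreover have "(\<Prod>j<N. complex_of_real (exp (- ((if j = k then \<theta> else 0)\<^sup>2 * l j) / 2)))
       = (\<Prod>j<N. if j = k then complex_of_real (exp (- (\<theta>\<^sup>2 * l j) / 2)) else 1)"
      by (intro prod.cong) auto
    ultimately show ?thesis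
      using char[of "\<lambda>j. if j = k then \<theta> else 0"] that by simp
  qed
  have varY: "expectation (\<lambda>\<omega>. (Y k \<omega>)\<^sup>2) = l k" if "k < N" for k
  proof -
    have "e k i = (\<Sum>j<N. (if j = k then 1 else 0) * e j i)" for i
    proof -
      have "(\<Sum>j<N. (if j = k then 1 else 0) * e j i) = (\<Sum>j<N. if j = k then e j i else 0)"
        by (intro sum.cong) auto
      then show ?thesis using that by simp
    qed
    from quad[OF this] have "expectation (\<lambda>\<omega>. (Y k \<omega>)\<^sup>2) = (\<Sum>j<N. (if j = k then 1 else 0)\<^sup>2 * l j)"
      unfolding Y_def varS .
    also have "\<dots> = (\<Sum>j<N. if j = k then l j else 0)"
      by (intro sum.cong) auto
    finally show ?thesis using that by simp
  qed
  have l0: "0 \<le> l k" if "k < N" for k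
    unfolding varY[OF that, symmetric] by simp
  have lR: "l k \<le> R" if "k < N" for k
    using eigenvalue_le_row_sum[of N \<Gamma> R "e k" "l k"] row eig orth that by fastforce
  have "(LINT \<omega>|M. iexp (t * (\<Sum>j<N. (\<xi> j \<omega>)\<^sup>2)))
      = (\<Prod>k<N. LINT x|std_normal_distribution. iexp (t * (l k * x\<^sup>2)))" for t
  proof -
    have "(\<Sum>k<N. (Y k \<omega>)\<^sup>2) = (\<Sum>j<N. (\<xi> j \<omega>)\<^sup>2)" for \<omega>
      using spectral_parseval[of N e "\<lambda>j. \<xi> j \<omega>" "\<lambda>j. \<xi> j \<omega>", OF compl]
      by (simp add: Y_def S_def power2_eq_square mult.commute)
    then have "(LINT \<omega>|M. iexp (t * (\<Sum>j<N. (\<xi> j \<omega>)\<^sup>2))) = (LINT \<omega>|M. iexp (t * (\<Sum>k<N. (Y k \<omega>)\<^sup>2)))"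
      by simp
    also have "\<dots> = (\<Prod>k<N. LINT \<omega>|M. iexp (t * (Y k \<omega>)\<^sup>2))"
    proof (rule char_sum_squares_eq_prod)
      show "random_variable borel (Y k)" for k unfolding Y_def S_def by measurable
      show "(LINT \<omega>|M. iexp (\<Sum>k<N. \<theta> k * Y k \<omega>)) = (\<Prod>k<N. LINT \<omega>|M. iexp (\<theta> k * Y k \<omega>))" for \<theta>
        unfolding char using char1 by (intro prod.cong) auto
    qed
    also have "\<dots> = (\<Prod>k<N. LINT x|std_normal_distribution. iexp (t * (l k * x\<^sup>2)))"
    proof (intro prod.cong refl)
      fix k assume "k \<in> {..<N}"
      then have k: "k < N" by simp
      have "gaussian_rv M (Y k)" "expectation (Y k) = 0"
        unfolding Y_def using meanS gauss[of "e k"] by (auto simp: S_def[abs_def])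
      from gaussian_rv_integral[OF M this varY[OF k], of "\<lambda>y. iexp (t * y\<^sup>2)"]
      show "(LINT \<omega>|M. iexp (t * (Y k \<omega>)\<^sup>2)) = (LINT x|std_normal_distribution. iexp (t * (l k * x\<^sup>2)))"
        using l0[OF k] by (simp add: power_mult_distrib flip: of_real_power)
    qed
    finally show ?thesis .
  qed
  then show ?thesis
    using l0 lR symmetric_matrix_eigenvalue_sums[of N e \<Gamma> l, OF compl orth eig]
    by (intro exI[of _ l]) auto
qed

section \<open>Central limit theorem for Gaussian squares\<close>

lemma real_distribution_centered_normal: "0 < v \<Longrightarrow> real_distribution (centered_normal v)"
  unfolding centered_normal_eq_distr
  by (intro prob_space.real_distribution_distr) (auto simp: real_distribution.axioms(1)[OF real_dist_normal_dist])

lemma char_centered_normal: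
  assumes "0 < v"
  shows "char (centered_normal v) t = complex_of_real (exp (- (v * t\<^sup>2) / 2))"
proof -
  have "(LINT x|std_normal_distribution. iexp (t * (sqrt v * x))) = complex_of_real (exp (- (t * sqrt v)\<^sup>2 / 2))"
    using std_normal_iexp[of "t * sqrt v"] by (simp add: mult_ac)
  then show ?thesis
    using assms unfolding centered_normal_eq_distr[OF assms] char_def
    by (simp add: integral_distr power_mult_distrib mult_ac)
qed

text \<open>Levy's continuity theorem, in both directions: weak limits are handled only through
  characteristic functions from here on.\<close>

lemma conv_in_distr_normal_iff:
  assumes M: "prob_space M" and [measurable]: "\<And>n. Y n \<in> borel_measurable M" and v: "0 < v"
  shows "conv_in_distr M Y (centered_normal v) \<longleftrightarrow>
    (\<forall>t. (\<lambda>n. LINT \<omega>|M. iexp (t * Y n \<omega>)) \<longlonglongrightarrow> complex_of_real (exp (- (v * t\<^sup>2) / 2)))"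
proof -
  interpret prob_space M by fact
  have c: "char (distr M borel (Y n)) t = (LINT \<omega>|M. iexp (t * Y n \<omega>))" for n t
    by (simp add: char_def integral_distr)
  have r: "real_distribution (distr M borel (Y n))" for n
    by (rule real_distribution_distr) simp
  show ?thesis
    unfolding conv_in_distr_def
    using levy_continuity1[of "\<lambda>n. distr M borel (Y n)", OF r real_distribution_centered_normal[OF v]]
      levy_continuity[of "\<lambda>n. distr M borel (Y n)", OF r real_distribution_centered_normal[OF v]]
    unfolding c char_centered_normal[OF v] by blast
qed

lemma centered_normal_inj:
  assumes "0 < v" "0 < w" "\<And>t. exp (- (v * t\<^sup>2) / 2) = exp (- (w * t\<^sup>2) / 2 :: real)"
  shows "v = w"
  using assms(3)[of 1] by simp

text \<open>The variable is \<open>X = x\<^sup>2 - 1\<close> under the standard normal law, with mean 0 and variance 2.\<close>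

lemma centered_square_char_approx:
  obtains C where "0 \<le> C"
    "\<And>v. \<bar>v\<bar> \<le> 1 \<Longrightarrow> cmod ((LINT x|std_normal_distribution. iexp (v * (x\<^sup>2 - 1))) - complex_of_real (exp (- v\<^sup>2))) \<le> C * \<bar>v\<bar> ^ 3"
proof -
  interpret N: real_distribution std_normal_distribution by (rule real_dist_normal_dist)
  note mom = integrable_std_normal_distribution_moment
  have m2: "(LINT x|std_normal_distribution. x\<^sup>2) = 1" "(LINT x|std_normal_distribution. x^4) = 3"
    using std_normal_distribution_even_moments(1)[of 1] std_normal_distribution_even_moments(1)[of 2]
    by (simp_all add: fact_numeral)
  have sq: "(x\<^sup>2 - 1)\<^sup>2 = x ^ 4 - 2 * x\<^sup>2 + 1" for x :: real by algebra
  have cube: "(x\<^sup>2 + 1) ^ 3 = x ^ 6 + 3 * x ^ 4 + 3 * x\<^sup>2 + 1" for x :: real by algebra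
  have int1: "integrable std_normal_distribution (\<lambda>x. x\<^sup>2 - 1)"
    using mom[of 2] by auto
  have int2: "integrable std_normal_distribution (\<lambda>x. (x\<^sup>2 - 1)\<^sup>2)"
    unfolding sq using mom[of 2] mom[of 4] by auto
  have int3: "integrable std_normal_distribution (\<lambda>x. \<bar>x\<^sup>2 - 1\<bar> ^ 3)"
  proof (rule Bochner_Integration.integrable_bound[of _ "\<lambda>x. (x\<^sup>2 + 1) ^ 3"])
    show "integrable std_normal_distribution (\<lambda>x. (x\<^sup>2 + 1) ^ 3)"
      unfolding cube using mom[of 2] mom[of 4] mom[of 6] by auto
    have "\<bar>x\<^sup>2 - 1\<bar> ^ 3 \<le> (x\<^sup>2 + 1) ^ 3" for x :: real
      by (intro power_mono) (auto simp: abs_if)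
    then show "AE x in std_normal_distribution. norm (\<bar>x\<^sup>2 - 1\<bar> ^ 3) \<le> norm ((x\<^sup>2 + 1) ^ 3 :: real)"
      by auto
  qed simp
  define D where "D = (LINT x|std_normal_distribution. \<bar>x\<^sup>2 - 1\<bar> ^ 3)"
  have D: "0 \<le> D" unfolding D_def by (rule integral_nonneg_AE) auto
  have mean: "N.expectation (\<lambda>x. x\<^sup>2 - 1) = 0"
    using mom[of 2] m2 N.prob_space by (subst Bochner_Integration.integral_diff) auto
  have var: "N.variance (\<lambda>x. x\<^sup>2 - 1) = 2"
    unfolding mean using mom[of 2] mom[of 4] m2 N.prob_space by (simp add: sq)
  have "cmod ((LINT x|std_normal_distribution. iexp (v * (x\<^sup>2 - 1))) - complex_of_real (exp (- v\<^sup>2))) \<le> (D + 1) * \<bar>v\<bar> ^ 3"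
    if v: "\<bar>v\<bar> \<le> 1" for v
  proof -
    \<comment> \<open>The variance 2 makes the second order expansion \<open>1 - v\<^sup>2\<close>,
      which \<open>exp (- v\<^sup>2)\<close> shares.\<close>
    have "cmod (char (distr std_normal_distribution borel (\<lambda>x. x\<^sup>2 - 1)) v - (1 - v\<^sup>2 * 2 / 2))
        \<le> (v\<^sup>2 / 6) * N.expectation (\<lambda>x. min (6 * (x\<^sup>2 - 1)\<^sup>2) (\<bar>v\<bar> * \<bar>x\<^sup>2 - 1\<bar> ^ 3))"
      using int1 int2 mean var by (intro N.char_approx3') auto
    also have "N.expectation (\<lambda>x. min (6 * (x\<^sup>2 - 1)\<^sup>2) (\<bar>v\<bar> * \<bar>x\<^sup>2 - 1\<bar> ^ 3)) \<le> N.expectation (\<lambda>x. \<bar>v\<bar> * \<bar>x\<^sup>2 - 1\<bar> ^ 3)"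
      using int2 int3 by (intro integral_mono Bochner_Integration.integrable_min integrable_mult_right) auto
    also have "\<dots> = \<bar>v\<bar> * D" by (simp add: D_def)
    finally have 1: "cmod (char (distr std_normal_distribution borel (\<lambda>x. x\<^sup>2 - 1)) v - complex_of_real (1 - v\<^sup>2)) \<le> v\<^sup>2 / 6 * (\<bar>v\<bar> * D)"
      by (simp add: mult_left_mono)
    also have "\<dots> \<le> D * \<bar>v\<bar> ^ 3"
    proof -
      have "v\<^sup>2 * \<bar>v\<bar> = \<bar>v\<bar> ^ 3"
        by (metis power2_abs power3_eq_cube power2_eq_square)
      then have "v\<^sup>2 / 6 * (\<bar>v\<bar> * D) = (D * \<bar>v\<bar> ^ 3) / 6"
        by (metis mult.assoc mult.commute times_divide_eq_left)
      moreover have "0 \<le> D * \<bar>v\<bar> ^ 3" using D by simp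
      ultimately show ?thesis by linarith
    qed
    finally have 1: "cmod (char (distr std_normal_distribution borel (\<lambda>x. x\<^sup>2 - 1)) v - complex_of_real (1 - v\<^sup>2)) \<le> D * \<bar>v\<bar> ^ 3" .
    \<comment> \<open>With \<open>y = v\<^sup>2\<close> the chain \<open>1 - y \<le> exp (- y) \<le>
      1 / (1 + y) \<le> 1 - y + y\<^sup>2\<close> traps the expansion error within
      \<open>v ^ 4\<close>, and \<open>\<bar>v\<bar> \<le> 1\<close> lowers the power to 3.\<close>
    have "exp (- v\<^sup>2) \<le> 1 / (1 + v\<^sup>2)"
      using exp_ge_add_one_self[of "v\<^sup>2"] by (simp add: exp_minus field_simps add_pos_nonneg)
    also have "\<dots> \<le> 1 - v\<^sup>2 + v ^ 4"
    proof -
      have "1 \<le> (1 - v\<^sup>2 + v ^ 4) * (1 + v\<^sup>2)"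
        by (simp add: algebra_simps flip: power_add)
      then show ?thesis by (simp add: divide_le_eq add_pos_nonneg)
    qed
    finally have "\<bar>(1 - v\<^sup>2) - exp (- v\<^sup>2)\<bar> \<le> v ^ 4"
      using exp_ge_add_one_self[of "- v\<^sup>2"] by auto
    also have "v ^ 4 \<le> \<bar>v\<bar> ^ 3"
      using power_decreasing[of 3 4 "\<bar>v\<bar>"] v by simp
    finally have 2: "cmod (complex_of_real (1 - v\<^sup>2) - complex_of_real (exp (- v\<^sup>2))) \<le> \<bar>v\<bar> ^ 3"
      by (simp only: norm_of_real flip: of_real_diff)
    have "(LINT x|std_normal_distribution. iexp (v * (x\<^sup>2 - 1))) = char (distr std_normal_distribution borel (\<lambda>x. x\<^sup>2 - 1)) v"
      by (simp add: char_def integral_distr)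
    then show ?thesis
      using norm_triangle_le[OF add_mono[OF 1 2]] by (simp add: algebra_simps)
  qed
  then show ?thesis using that[of "D + 1"] D by simp
qed

text \<open>Both products have factors of modulus at most 1, so their difference is at most the sum
  of the differences of the factors. Each of these is of third order, and
  \<open>l k ^ 3 \<le> R * (l k)\<^sup>2\<close> leaves the sum of squares. The leading phase
  replaces every \<open>x\<^sup>2\<close> by its centred version \<open>x\<^sup>2 - 1\<close>.
  \<open>C\<close> precedes all other quantifiers, since \<open>N\<close> will grow with n.\<close>

lemma prod_centered_square_char_approx:
  obtains C where "0 \<le> C"
    "\<And>(N::nat) l t R. (\<And>k. k < N \<Longrightarrow> 0 \<le> l k \<and> l k \<le> R) \<Longrightarrow> \<bar>t\<bar> * R \<le> 1 \<Longrightarrow>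
      cmod (iexp (- t * (\<Sum>k<N. l k)) * (\<Prod>k<N. LINT x|std_normal_distribution. iexp (t * (l k * x\<^sup>2)))
        - complex_of_real (exp (- t\<^sup>2 * (\<Sum>k<N. (l k)\<^sup>2)))) \<le> C * \<bar>t\<bar> ^ 3 * R * (\<Sum>k<N. (l k)\<^sup>2)"
proof -
  interpret N: real_distribution std_normal_distribution by (rule real_dist_normal_dist)
  define \<psi> where "\<psi> v = (LINT x|std_normal_distribution. iexp (v * (x\<^sup>2 - 1)))" for v
  obtain C where C: "0 \<le> C"
    and bnd: "\<And>v. \<bar>v\<bar> \<le> 1 \<Longrightarrow> cmod (\<psi> v - complex_of_real (exp (- v\<^sup>2))) \<le> C * \<bar>v\<bar> ^ 3"
    unfolding \<psi>_def using centered_square_char_approx by metis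
  have \<psi>1: "cmod (\<psi> v) \<le> 1" for v
  proof -
    have "cmod (\<psi> v) \<le> (LINT x|std_normal_distribution. cmod (iexp (v * (x\<^sup>2 - 1))))"
      unfolding \<psi>_def by (rule integral_norm_bound)
    then show ?thesis using N.prob_space by (simp del: of_real_mult)
  qed
  have "cmod (iexp (- t * (\<Sum>k<N. l k)) * (\<Prod>k<N. LINT x|std_normal_distribution. iexp (t * (l k * x\<^sup>2)))
        - complex_of_real (exp (- t\<^sup>2 * (\<Sum>k<N. (l k)\<^sup>2)))) \<le> C * \<bar>t\<bar> ^ 3 * R * (\<Sum>k<N. (l k)\<^sup>2)"
    if l: "\<And>k. k < N \<Longrightarrow> 0 \<le> l k \<and> l k \<le> R" and tR: "\<bar>t\<bar> * R \<le> 1" for N :: nat and l t R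
  proof -
    have "iexp (- t * (\<Sum>k<N. l k)) = (\<Prod>k<N. iexp (- t * l k))"
      by (simp add: sum_distrib_left exp_sum flip: sum_negf)
    moreover have "iexp (- t * l k) * (LINT x|std_normal_distribution. iexp (t * (l k * x\<^sup>2))) = \<psi> (t * l k)" for k
      unfolding \<psi>_def integral_mult_right_zero[symmetric]
      by (intro Bochner_Integration.integral_cong refl) (simp add: algebra_simps flip: exp_add)
    ultimately have "iexp (- t * (\<Sum>k<N. l k)) * (\<Prod>k<N. LINT x|std_normal_distribution. iexp (t * (l k * x\<^sup>2)))
      = (\<Prod>k<N. \<psi> (t * l k))"
      by (simp only: prod.distrib[symmetric])
    moreover have "complex_of_real (exp (- t\<^sup>2 * (\<Sum>k<N. (l k)\<^sup>2))) = (\<Prod>k<N. complex_of_real (exp (- (t * l k)\<^sup>2)))"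
      unfolding of_real_prod[symmetric]
      by (subst exp_sum[symmetric]) (simp_all add: power_mult_distrib sum_distrib_left sum_negf)
    moreover have "cmod ((\<Prod>k<N. \<psi> (t * l k)) - (\<Prod>k<N. complex_of_real (exp (- (t * l k)\<^sup>2))))
        \<le> (\<Sum>k<N. cmod (\<psi> (t * l k) - complex_of_real (exp (- (t * l k)\<^sup>2))))"
      using \<psi>1 by (intro norm_prod_diff) auto
    moreover have "\<dots> \<le> (\<Sum>k<N. C * \<bar>t\<bar> ^ 3 * R * (l k)\<^sup>2)"
    proof (rule sum_mono)
      fix k assume "k \<in> {..<N}"
      then have lk: "0 \<le> l k" "l k \<le> R" using l by auto
      then have "\<bar>t * l k\<bar> \<le> 1"
        using mult_left_mono[of "l k" R "\<bar>t\<bar>"] tR by (simp add: abs_mult)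
      from bnd[OF this] have "cmod (\<psi> (t * l k) - complex_of_real (exp (- (t * l k)\<^sup>2))) \<le> C * \<bar>t * l k\<bar> ^ 3" .
      also have "\<dots> = C * \<bar>t\<bar> ^ 3 * (l k * (l k)\<^sup>2)"
        using lk by (simp add: abs_mult power_mult_distrib power3_eq_cube power2_eq_square)
      also have "\<dots> \<le> C * \<bar>t\<bar> ^ 3 * (R * (l k)\<^sup>2)"
        using lk C by (intro mult_left_mono mult_right_mono) auto
      finally show "cmod (\<psi> (t * l k) - complex_of_real (exp (- (t * l k)\<^sup>2))) \<le> C * \<bar>t\<bar> ^ 3 * R * (l k)\<^sup>2"
        by (simp add: mult_ac)
    qed
    ultimately show ?thesis by (simp add: sum_distrib_left)
  qed
  then show ?thesis using that C by blast
qed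

text \<open>The unit diagonal makes the eigenvalues sum to \<open>N n\<close>, which is the
  centring. At frequency t over sqrt n the error is of order \<open>R * (Q n / n)\<close> over sqrt
  n, while \<open>exp (- t\<^sup>2 * (Q n / n))\<close> tends to the characteristic function of the
  normal law with variance \<open>v\<close>; hence \<open>v / 2\<close> in the hypothesis.\<close>

theorem gaussian_square_sum_clt:
  fixes \<xi> :: "nat \<Rightarrow> nat \<Rightarrow> 'a \<Rightarrow> real" and \<Gamma> :: "nat \<Rightarrow> nat \<Rightarrow> nat \<Rightarrow> real"
  assumes M: "prob_space M"
    and gauss: "\<And>n c. 0 < n \<Longrightarrow> gaussian_rv M (\<lambda>\<omega>. \<Sum>j<N n. c j * \<xi> n j \<omega>)"
    and int: "\<And>n j. integrable M (\<xi> n j)" "\<And>n i j. integrable M (\<lambda>\<omega>. \<xi> n i \<omega> * \<xi> n j \<omega>)"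
    and mean: "\<And>n j. 0 < n \<Longrightarrow> prob_space.expectation M (\<xi> n j) = 0"
    and cov: "\<And>n i j. 0 < n \<Longrightarrow> prob_space.expectation M (\<lambda>\<omega>. \<xi> n i \<omega> * \<xi> n j \<omega>) = \<Gamma> n i j"
    and row: "\<And>n i. (\<Sum>j<N n. \<bar>\<Gamma> n i j\<bar>) \<le> R"
    and diag: "\<And>n i. \<Gamma> n i i = 1"
    and lim: "(\<lambda>n. (\<Sum>i<N n. \<Sum>j<N n. (\<Gamma> n i j)\<^sup>2) / real n) \<longlonglongrightarrow> v / 2" and v: "0 < v"
  shows "conv_in_distr M (\<lambda>n \<omega>. (\<Sum>j<N n. (\<xi> n j \<omega>)\<^sup>2 - 1) / sqrt (real n)) (centered_normal v)"
proof -
  interpret prob_space M by fact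
  have [measurable]: "\<xi> n j \<in> borel_measurable M" for n j using int(1)[of n j] by simp
  define Q where "Q n = (\<Sum>i<N n. \<Sum>j<N n. (\<Gamma> n i j)\<^sup>2)" for n
  obtain C where C: "0 \<le> C" and approx: "\<And>(N::nat) l t R. (\<And>k. k < N \<Longrightarrow> 0 \<le> l k \<and> l k \<le> R) \<Longrightarrow> \<bar>t\<bar> * R \<le> 1 \<Longrightarrow>
      cmod (iexp (- t * (\<Sum>k<N. l k)) * (\<Prod>k<N. LINT x|std_normal_distribution. iexp (t * (l k * x\<^sup>2)))
        - complex_of_real (exp (- t\<^sup>2 * (\<Sum>k<N. (l k)\<^sup>2)))) \<le> C * \<bar>t\<bar> ^ 3 * R * (\<Sum>k<N. (l k)\<^sup>2)"
    using prod_centered_square_char_approx by blast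
  have bound: "cmod ((LINT \<omega>|M. iexp (t * (\<Sum>j<N n. (\<xi> n j \<omega>)\<^sup>2 - 1))) - complex_of_real (exp (- t\<^sup>2 * Q n)))
      \<le> C * \<bar>t\<bar> ^ 3 * R * Q n" if n: "0 < n" and tR: "\<bar>t\<bar> * R \<le> 1" for n t
  proof -
    obtain l where l: "\<forall>k<N n. 0 \<le> l k \<and> l k \<le> R" and tr: "(\<Sum>k<N n. l k) = (\<Sum>i<N n. \<Gamma> n i i)"
      and tr2: "(\<Sum>k<N n. (l k)\<^sup>2) = Q n"
      and ch: "\<forall>t. (LINT \<omega>|M. iexp (t * (\<Sum>j<N n. (\<xi> n j \<omega>)\<^sup>2)))
        = (\<Prod>k<N n. LINT x|std_normal_distribution. iexp (t * (l k * x\<^sup>2)))"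
      unfolding Q_def
      using gaussian_square_sum_char[OF M gauss[OF n] int(1) int(2) mean[OF n] cov[OF n] row] by blast
    have trN: "(\<Sum>k<N n. l k) = real (N n)" using tr diag by simp
    have "(LINT \<omega>|M. iexp (t * (\<Sum>j<N n. (\<xi> n j \<omega>)\<^sup>2 - 1)))
        = iexp (- t * real (N n)) * (LINT \<omega>|M. iexp (t * (\<Sum>j<N n. (\<xi> n j \<omega>)\<^sup>2)))"
      unfolding integral_mult_right_zero[symmetric]
      by (intro Bochner_Integration.integral_cong refl)
         (simp add: sum_subtractf algebra_simps flip: exp_add)
    then show ?thesis
      using approx[of "N n" l R t] l tR unfolding trN tr2 by (simp only: ch simp_thms)
  qed
  have lim': "(\<lambda>n. Q n / real n) \<longlonglongrightarrow> v / 2" using lim by (simp add: Q_def)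
  show ?thesis
  proof (subst conv_in_distr_normal_iff[OF M _ v], simp, intro allI)
    fix t :: real
    have s0: "(\<lambda>n. 1 / sqrt (real n)) \<longlonglongrightarrow> 0" by real_asymp
    have 1: "(\<lambda>n. complex_of_real (exp (- t\<^sup>2 * (Q n / real n)))) \<longlonglongrightarrow> complex_of_real (exp (- (v * t\<^sup>2) / 2))"
    proof -
      have "(\<lambda>n. complex_of_real (exp (- t\<^sup>2 * (Q n / real n)))) \<longlonglongrightarrow> complex_of_real (exp (- t\<^sup>2 * (v / 2)))"
        by (intro tendsto_intros lim')
      then show ?thesis by (simp add: mult.commute)
    qed
    have 2: "(\<lambda>n. (LINT \<omega>|M. iexp (t * ((\<Sum>j<N n. (\<xi> n j \<omega>)\<^sup>2 - 1) / sqrt (real n))))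
        - complex_of_real (exp (- t\<^sup>2 * (Q n / real n)))) \<longlonglongrightarrow> 0"
    proof (rule Lim_null_comparison)
      have "(\<lambda>n. C * \<bar>t\<bar> ^ 3 * R * (Q n / real n) * (1 / sqrt (real n))) \<longlonglongrightarrow> C * \<bar>t\<bar> ^ 3 * R * (v / 2) * 0"
        by (intro tendsto_intros lim' s0)
      then show "(\<lambda>n. C * \<bar>t\<bar> ^ 3 * R * (Q n / real n) * (1 / sqrt (real n))) \<longlonglongrightarrow> 0" by simp
      have "(\<lambda>n. \<bar>t\<bar> * R * (1 / sqrt (real n))) \<longlonglongrightarrow> \<bar>t\<bar> * R * 0"
        by (intro tendsto_intros s0)
      then have "\<forall>\<^sub>F n in sequentially. \<bar>t\<bar> * R * (1 / sqrt (real n)) < 1"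
        by (rule order_tendstoD) simp
      then show "\<forall>\<^sub>F n in sequentially. cmod ((LINT \<omega>|M. iexp (t * ((\<Sum>j<N n. (\<xi> n j \<omega>)\<^sup>2 - 1) / sqrt (real n))))
        - complex_of_real (exp (- t\<^sup>2 * (Q n / real n)))) \<le> C * \<bar>t\<bar> ^ 3 * R * (Q n / real n) * (1 / sqrt (real n))"
        using eventually_gt_at_top[of 0]
      proof eventually_elim
        case (elim n)
        define u where "u = t / sqrt (real n)"
        have "\<bar>u\<bar> * R \<le> 1" using elim by (simp add: u_def abs_divide)
        from bound[OF elim(2) this]
        have b: "cmod ((LINT \<omega>|M. iexp (u * (\<Sum>j<N n. (\<xi> n j \<omega>)\<^sup>2 - 1))) - complex_of_real (exp (- u\<^sup>2 * Q n)))
          \<le> C * \<bar>u\<bar> ^ 3 * R * Q n" .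
        have u: "u\<^sup>2 * Q n = t\<^sup>2 * (Q n / real n)" "\<And>z. u * z = t * (z / sqrt (real n))"
          by (simp_all add: u_def power_divide)
        have "\<bar>u\<bar> ^ 3 = \<bar>t\<bar> ^ 3 / (real n * sqrt (real n))"
          using elim by (simp add: u_def abs_divide power_divide power3_eq_cube)
        then have u3: "C * \<bar>u\<bar> ^ 3 * R * Q n = C * \<bar>t\<bar> ^ 3 * R * (Q n / real n) * (1 / sqrt (real n))"
          by simp
        show ?case using b unfolding u3 by (simp only: u minus_mult_left[symmetric])
      qed
    qed
    show "(\<lambda>n. LINT \<omega>|M. iexp (t * ((\<Sum>j<N n. (\<xi> n j \<omega>)\<^sup>2 - 1) / sqrt (real n))))
        \<longlonglongrightarrow> complex_of_real (exp (- (v * t\<^sup>2) / 2))"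
      using tendsto_add[OF 2 1] by simp
  qed
qed

section \<open>Covariances of filtered fractional Gaussian noise\<close>

text \<open>For \<open>\<beta> = 2 * H\<close> this is twice the covariance at lag \<open>m\<close>
  of the unit increments of fractional Brownian motion: a second difference of the power
  function.\<close>

definition fgn_cov :: "real \<Rightarrow> int \<Rightarrow> real" where
  "fgn_cov \<beta> m = \<bar>of_int (m + 1)\<bar> powr \<beta> + \<bar>of_int (m - 1)\<bar> powr \<beta> - 2 * \<bar>of_int m\<bar> powr \<beta>"

lemma fgn_cov_minus: "fgn_cov \<beta> (- m) = fgn_cov \<beta> m"
proof -
  have "\<bar>of_int (- m + 1)\<bar> = \<bar>of_int (m - 1) :: real\<bar>" "\<bar>of_int (- m - 1)\<bar> = \<bar>of_int (m + 1) :: real\<bar>"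
    by auto
  then show ?thesis by (simp add: fgn_cov_def)
qed

lemma fgn_cov_0: "fgn_cov \<beta> 0 = 2"
  by (simp add: fgn_cov_def)

text \<open>The right side is the tangent at 1 of a concave function; Young's inequality with second
  factor 1 is this bound.\<close>

lemma powr_le_tangent:
  fixes u :: real
  assumes "0 < \<beta>" "\<beta> < 1" "0 \<le> u"
  shows "u powr \<beta> \<le> \<beta> * u + (1 - \<beta>)"
proof (cases "u = 0")
  case False
  then show ?thesis
    using Youngs_inequality_0[of \<beta> "1 - \<beta>" u 1] assms by simp
qed (use assms in simp)

text \<open>After scaling by \<open>m\<close> the neighbours sit at \<open>1 + 1 / m\<close> and
  \<open>1 - 1 / m\<close>, where the linear terms of the two tangent bounds cancel.\<close>

lemma fgn_cov_nonpos:
  assumes \<beta>: "0 < \<beta>" "\<beta> < 1" and m: "0 < m"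
  shows "fgn_cov \<beta> m \<le> 0"
proof -
  define x where "x = real_of_int m"
  have x: "1 \<le> x" using m by (simp add: x_def)
  have eq: "(x * u) powr \<beta> = x powr \<beta> * u powr \<beta>" if "0 \<le> u" for u
    using x that by (simp add: powr_mult)
  have "(x + 1) powr \<beta> = x powr \<beta> * (1 + 1 / x) powr \<beta>"
    using eq[of "1 + 1 / x"] x by (simp add: distrib_left)
  also have "\<dots> \<le> x powr \<beta> * (\<beta> * (1 + 1 / x) + (1 - \<beta>))"
    using \<beta> x by (intro mult_left_mono powr_le_tangent) auto
  finally have 1: "(x + 1) powr \<beta> \<le> x powr \<beta> * (\<beta> * (1 + 1 / x) + (1 - \<beta>))" .
  have "(x - 1) powr \<beta> = x powr \<beta> * (1 - 1 / x) powr \<beta>"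
    using eq[of "1 - 1 / x"] x by (simp add: right_diff_distrib)
  also have "\<dots> \<le> x powr \<beta> * (\<beta> * (1 - 1 / x) + (1 - \<beta>))"
    using \<beta> x by (intro mult_left_mono powr_le_tangent) auto
  finally have 2: "(x - 1) powr \<beta> \<le> x powr \<beta> * (\<beta> * (1 - 1 / x) + (1 - \<beta>))" .
  have "(x + 1) powr \<beta> + (x - 1) powr \<beta>
      \<le> x powr \<beta> * (\<beta> * (1 + 1 / x) + (1 - \<beta>)) + x powr \<beta> * (\<beta> * (1 - 1 / x) + (1 - \<beta>))"
    using 1 2 by simp
  also have "\<dots> = 2 * x powr \<beta>" by (simp add: algebra_simps)
  finally show ?thesis
    using x by (simp add: fgn_cov_def x_def)
qed

text \<open>By concavity all terms have the same sign, so the sum of absolute values telescopes.\<close>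

lemma sum_abs_fgn_cov:
  assumes \<beta>: "0 < \<beta>" "\<beta> < 1"
  shows "(\<Sum>d<D. \<bar>fgn_cov \<beta> (int (Suc d))\<bar>) = 1 - (real (Suc D) powr \<beta> - real D powr \<beta>)"
proof (induction D)
  case 0
  then show ?case using \<beta> by simp
next
  case (Suc D)
  have "fgn_cov \<beta> (int (Suc D)) = real (Suc (Suc D)) powr \<beta> + real D powr \<beta> - 2 * real (Suc D) powr \<beta>"
    by (simp add: fgn_cov_def add_ac)
  moreover have "fgn_cov \<beta> (int (Suc D)) \<le> 0"
    by (rule fgn_cov_nonpos[OF \<beta>]) simp
  ultimately show ?case using Suc.IH by simp
qed

lemma sum_abs_fgn_cov_less:
  assumes \<beta>: "0 < \<beta>" "\<beta> < 1"
  shows "(\<Sum>d<D. \<bar>fgn_cov \<beta> (int (Suc d))\<bar>) < 1"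
proof -
  have "real D powr \<beta> < real (Suc D) powr \<beta>"
    using \<beta> by (intro powr_less_mono2) auto
  then show ?thesis unfolding sum_abs_fgn_cov[OF \<beta>] by simp
qed

lemma sum_symmetric_int:
  fixes c :: "int \<Rightarrow> real"
  assumes "\<And>m. c (- m) = c m"
  shows "(\<Sum>m\<in>{- int D..int D}. c m) = c 0 + 2 * (\<Sum>d<D. c (int (Suc d)))"
proof (induction D)
  case (Suc D)
  have "{- int (Suc D)..int (Suc D)} = insert (int (Suc D)) (insert (- int (Suc D)) {- int D..int D})"
    by auto
  then have "(\<Sum>m\<in>{- int (Suc D)..int (Suc D)}. c m) = c (int (Suc D)) + (c (- int (Suc D)) + (\<Sum>m\<in>{- int D..int D}. c m))"
    by (simp only:) (subst sum.insert; auto)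
  then show ?case using Suc.IH assms[of "int (Suc D)"] by simp
qed simp

text \<open>The bound is the diagonal value \<open>fgn_cov \<beta> 0\<close>. Over all nonzero lags
  the sums approach 2, so the strictness, which diagonal dominance needs, comes from the finiteness
  of \<open>F\<close>.\<close>

lemma sum_abs_fgn_cov_off_diagonal:
  assumes \<beta>: "0 < \<beta>" "\<beta> < 1" and F: "finite F" "0 \<notin> F"
  shows "(\<Sum>m\<in>F. \<bar>fgn_cov \<beta> m\<bar>) < 2"
proof -
  obtain D where D: "F \<subseteq> {- int D..int D}"
  proof -
    have "\<forall>m\<in>F. \<bar>m\<bar> \<le> Max (insert 0 (abs ` F))" using F by auto
    then show ?thesis by (intro that[of "nat (Max (insert 0 (abs ` F)))"]) force
  qed
  have "(\<Sum>m\<in>F. \<bar>fgn_cov \<beta> m\<bar>) \<le> (\<Sum>m\<in>{- int D..int D} - {0}. \<bar>fgn_cov \<beta> m\<bar>)"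
    using D F by (intro sum_mono2) auto
  also have "\<dots> = (\<Sum>m\<in>{- int D..int D}. \<bar>fgn_cov \<beta> m\<bar>) - 2"
    by (subst sum_diff1) (auto simp: fgn_cov_0)
  also have "\<dots> = 2 * (\<Sum>d<D. \<bar>fgn_cov \<beta> (int (Suc d))\<bar>)"
    by (subst sum_symmetric_int) (auto simp: fgn_cov_minus fgn_cov_0)
  also have "\<dots> < 2" using sum_abs_fgn_cov_less[OF \<beta>, of D] by simp
  finally show ?thesis .
qed

lemma sum_abs_fgn_cov_le:
  assumes \<beta>: "0 < \<beta>" "\<beta> < 1" and F: "finite F"
  shows "(\<Sum>m\<in>F. \<bar>fgn_cov \<beta> m\<bar>) \<le> 4"
proof -
  have "(\<Sum>m\<in>F. \<bar>fgn_cov \<beta> m\<bar>) \<le> (\<Sum>m\<in>insert 0 (F - {0}). \<bar>fgn_cov \<beta> m\<bar>)"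
    using F by (intro sum_mono2) auto
  also have "\<dots> = 2 + (\<Sum>m\<in>F - {0}. \<bar>fgn_cov \<beta> m\<bar>)"
    using F by (subst sum.insert) (auto simp: fgn_cov_0)
  finally show ?thesis
    using sum_abs_fgn_cov_off_diagonal[OF \<beta>, of "F - {0}"] F by simp
qed

text \<open>The covariance of two filter differences \<open>d\<close> steps apart at mesh size 1.
  Lags are integers, so that symmetry and the reindexing of matrix rows by lags need no case
  distinction.\<close>

definition filter_cov :: "real \<Rightarrow> nat \<Rightarrow> (nat \<Rightarrow> real) \<Rightarrow> int \<Rightarrow> real" where
  "filter_cov H p a d = - (\<Sum>k\<le>p. \<Sum>l\<le>p. a k * a l * \<bar>of_int (int k - int l + d)\<bar> powr (2 * H)) / 2"

lemma filter_var_eq_filter_cov: "filter_var H p a \<Delta> = \<Delta> powr (2 * H) * filter_cov H p a 0"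
  by (simp add: filter_var_def filter_cov_def)

lemma filter_cov_minus: "filter_cov H p a (- d) = filter_cov H p a d"
proof -
  have "(\<Sum>k\<le>p. \<Sum>l\<le>p. a k * a l * \<bar>of_int (int k - int l + - d)\<bar> powr (2 * H))
      = (\<Sum>k\<le>p. \<Sum>l\<le>p. a l * a k * \<bar>of_int (int l - int k + d)\<bar> powr (2 * H))"
  proof (intro sum.cong refl)
    fix k l
    have "\<bar>of_int (int k - int l + - d) :: real\<bar> = \<bar>of_int (int l - int k + d)\<bar>" by simp
    then show "a k * a l * \<bar>of_int (int k - int l + - d)\<bar> powr (2 * H) = a l * a k * \<bar>of_int (int l - int k + d)\<bar> powr (2 * H)"
      by (simp only: mult.commute[of "a k"])
  qed
  also have "\<dots> = (\<Sum>k\<le>p. \<Sum>l\<le>p. a k * a l * \<bar>of_int (int k - int l + d)\<bar> powr (2 * H))"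
    by (rule sum.swap)
  finally show ?thesis by (simp add: filter_cov_def)
qed

lemma sum_by_parts_zero_total:
  fixes a u :: "nat \<Rightarrow> real"
  assumes "(\<Sum>i\<le>p. a i) = 0"
  shows "(\<Sum>i\<le>p. a i * u i) = (\<Sum>q<p. (\<Sum>i\<le>q. a i) * (u q - u (Suc q)))"
proof -
  have "(\<Sum>i\<le>n. a i * u i) = (\<Sum>i\<le>n. a i) * u n + (\<Sum>q<n. (\<Sum>i\<le>q. a i) * (u q - u (Suc q)))" for n
    by (induction n) (simp_all add: algebra_simps)
  then show ?thesis using assms by simp
qed

text \<open>A filter difference is a combination of unit increments with weights
  \<open>- A q\<close>. Summing by parts in both indices turns the power function into its second
  difference and reverses the sign, which absorbs the minus sign of
  \<open>filter_cov\<close>.\<close>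

lemma filter_cov_by_parts:
  assumes a: "(\<Sum>i\<le>p. a i) = 0"
  defines "A \<equiv> \<lambda>q. \<Sum>i\<le>q. a i"
  shows "filter_cov H p a d = (\<Sum>q<p. \<Sum>s<p. A q * A s * fgn_cov (2 * H) (int q - int s + d)) / 2"
proof -
  define h where "h m = \<bar>of_int m :: real\<bar> powr (2 * H)" for m :: int
  have "(\<Sum>k\<le>p. \<Sum>l\<le>p. a k * a l * h (int k - int l + d)) = (\<Sum>k\<le>p. a k * (\<Sum>l\<le>p. a l * h (int k - int l + d)))"
    by (simp add: sum_distrib_left mult.assoc)
  also have "\<dots> = (\<Sum>k\<le>p. a k * (\<Sum>s<p. A s * (h (int k - int s + d) - h (int k - int (Suc s) + d))))"
    unfolding A_def by (simp only: sum_by_parts_zero_total[OF a])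
  also have "\<dots> = (\<Sum>q<p. A q * ((\<Sum>s<p. A s * (h (int q - int s + d) - h (int q - int (Suc s) + d)))
      - (\<Sum>s<p. A s * (h (int (Suc q) - int s + d) - h (int (Suc q) - int (Suc s) + d)))))"
    unfolding A_def by (rule sum_by_parts_zero_total[OF a])
  also have "\<dots> = (\<Sum>q<p. \<Sum>s<p. A q * A s * (- fgn_cov (2 * H) (int q - int s + d)))"
    unfolding sum_subtractf[symmetric] sum_distrib_left
  proof (intro sum.cong refl)
    fix q s
    have i: "int q - int (Suc s) + d = (int q - int s + d) - 1"
      "int (Suc q) - int s + d = (int q - int s + d) + 1"
      "int (Suc q) - int (Suc s) + d = int q - int s + d" by auto
    show "A q * (A s * (h (int q - int s + d) - h (int q - int (Suc s) + d)) -
           A s * (h (int (Suc q) - int s + d) - h (int (Suc q) - int (Suc s) + d)))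
      = A q * A s * - fgn_cov (2 * H) (int q - int s + d)"
      unfolding i fgn_cov_def h_def[symmetric] by (simp add: algebra_simps)
  qed
  finally show ?thesis
    unfolding filter_cov_def h_def by (simp add: sum_negf)
qed

text \<open>Otherwise summation by parts would annihilate every moment, against the nonzero moment
  that \<open>has_order\<close> provides.\<close>

lemma diff_filter_partial_sum_nonzero:
  assumes "is_diff_filter p a"
  shows "\<exists>q<p. (\<Sum>i\<le>q. a i) \<noteq> 0"
proof (rule ccontr)
  assume "\<not> ?thesis"
  then have z: "\<forall>q<p. (\<Sum>i\<le>q. a i) = 0" by blast
  obtain m where "(\<Sum>i\<le>p. a i * real i ^ m) \<noteq> 0" and "(\<Sum>i\<le>p. a i) = 0"
    using assms by (auto simp: is_diff_filter_def has_order_def)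
  then show False
    using z by (simp add: sum_by_parts_zero_total[of a p])
qed

text \<open>The matrix of \<open>fgn_cov\<close> is strictly diagonally dominant, hence positive definite.\<close>

lemma filter_cov_0_pos:
  assumes H: "0 < H" "H < 1/2" and a: "is_diff_filter p a"
  shows "0 < filter_cov H p a 0"
proof -
  define A where "A q = (\<Sum>i\<le>q. a i)" for q
  define \<rho> where "\<rho> = fgn_cov (2 * H)"
  have b: "0 < 2 * H" "2 * H < 1" using H by auto
  have a0: "(\<Sum>i\<le>p. a i) = 0" using a by (simp add: is_diff_filter_def)
  define off where "off q = (\<Sum>s\<in>{..<p} - {q}. \<bar>\<rho> (int q - int s)\<bar>)" for q
  have off: "off q < 2" for q
  proof -
    have "off q = (\<Sum>m\<in>(\<lambda>s. int q - int s) ` ({..<p} - {q}). \<bar>\<rho> m\<bar>)"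
      unfolding off_def by (subst sum.reindex) (auto simp: inj_on_def)
    also have "\<dots> < 2"
      unfolding \<rho>_def by (rule sum_abs_fgn_cov_off_diagonal[OF b]) auto
    finally show ?thesis .
  qed
  \<comment> \<open>Bounding \<open>\<bar>A q * A s\<bar>\<close> by the mean of the two squares
    charges half of each off-diagonal term to row \<open>q\<close> and half to row \<open>s\<close>;
    evenness of \<open>\<rho>\<close> allows all of it to be booked on row \<open>q\<close>.\<close>
  have sw: "(\<Sum>q<p. \<Sum>s\<in>{..<p} - {q}. (A s)\<^sup>2 * \<bar>\<rho> (int q - int s)\<bar>) = (\<Sum>q<p. \<Sum>s\<in>{..<p} - {q}. (A q)\<^sup>2 * \<bar>\<rho> (int q - int s)\<bar>)"
  proof -
    have "(\<Sum>q<p. \<Sum>s\<in>{..<p} - {q}. (A s)\<^sup>2 * \<bar>\<rho> (int q - int s)\<bar>)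
        = (\<Sum>q<p. \<Sum>s<p. if s = q then 0 else (A s)\<^sup>2 * \<bar>\<rho> (int q - int s)\<bar>)"
      by (intro sum.cong refl sum.mono_neutral_cong_left) auto
    also have "\<dots> = (\<Sum>q<p. \<Sum>s<p. if q = s then 0 else (A q)\<^sup>2 * \<bar>\<rho> (int s - int q)\<bar>)"
      by (rule sum.swap)
    also have "\<dots> = (\<Sum>q<p. \<Sum>s\<in>{..<p} - {q}. (A q)\<^sup>2 * \<bar>\<rho> (int q - int s)\<bar>)"
    proof (rule sum.cong[OF refl])
      fix q
      have "\<rho> (int s - int q) = \<rho> (int q - int s)" for s
        using fgn_cov_minus[of "2 * H" "int q - int s"] by (simp add: \<rho>_def)
      then show "(\<Sum>s<p. if q = s then 0 else (A q)\<^sup>2 * \<bar>\<rho> (int s - int q)\<bar>)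
          = (\<Sum>s\<in>{..<p} - {q}. (A q)\<^sup>2 * \<bar>\<rho> (int q - int s)\<bar>)"
        by (intro sum.mono_neutral_cong_right) auto
    qed
    finally show ?thesis .
  qed
  have "(\<Sum>q<p. (A q)\<^sup>2 * (2 - off q)) = (\<Sum>q<p. 2 * (A q)\<^sup>2) - (\<Sum>q<p. \<Sum>s\<in>{..<p} - {q}. (A q)\<^sup>2 * \<bar>\<rho> (int q - int s)\<bar>)"
    by (simp add: off_def sum_distrib_left right_diff_distrib sum_subtractf mult.commute)
  also have "\<dots> = (\<Sum>q<p. 2 * (A q)\<^sup>2) - ((\<Sum>q<p. \<Sum>s\<in>{..<p} - {q}. (A q)\<^sup>2 * \<bar>\<rho> (int q - int s)\<bar>)
      + (\<Sum>q<p. \<Sum>s\<in>{..<p} - {q}. (A s)\<^sup>2 * \<bar>\<rho> (int q - int s)\<bar>)) / 2"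
    unfolding sw by simp
  also have "\<dots> = (\<Sum>q<p. 2 * (A q)\<^sup>2 - (\<Sum>s\<in>{..<p} - {q}. ((A q)\<^sup>2 + (A s)\<^sup>2) / 2 * \<bar>\<rho> (int q - int s)\<bar>))"
    by (simp add: sum_subtractf sum.distrib[symmetric] sum_divide_distrib distrib_right add_divide_distrib)
  also have "\<dots> \<le> (\<Sum>q<p. 2 * (A q)\<^sup>2 + (\<Sum>s\<in>{..<p} - {q}. A q * A s * \<rho> (int q - int s)))"
  proof (intro sum_mono)
    fix q
    have "- (A q * A s * \<rho> (int q - int s)) \<le> ((A q)\<^sup>2 + (A s)\<^sup>2) / 2 * \<bar>\<rho> (int q - int s)\<bar>" for s
    proof -
      have "- (A q * A s * \<rho> (int q - int s)) \<le> \<bar>A q * A s\<bar> * \<bar>\<rho> (int q - int s)\<bar>"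
        using abs_ge_minus_self[of "A q * A s * \<rho> (int q - int s)"] by (simp add: abs_mult)
      also have "\<bar>A q * A s\<bar> \<le> ((A q)\<^sup>2 + (A s)\<^sup>2) / 2"
        using sum_squares_bound[of "\<bar>A q\<bar>" "\<bar>A s\<bar>"] by (simp add: abs_mult)
      finally show ?thesis by (simp add: mult_right_mono)
    qed
    then have "(\<Sum>s\<in>{..<p} - {q}. - (A q * A s * \<rho> (int q - int s))) \<le> (\<Sum>s\<in>{..<p} - {q}. ((A q)\<^sup>2 + (A s)\<^sup>2) / 2 * \<bar>\<rho> (int q - int s)\<bar>)"
      by (intro sum_mono)
    then show "2 * (A q)\<^sup>2 - (\<Sum>s\<in>{..<p} - {q}. ((A q)\<^sup>2 + (A s)\<^sup>2) / 2 * \<bar>\<rho> (int q - int s)\<bar>)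
        \<le> 2 * (A q)\<^sup>2 + (\<Sum>s\<in>{..<p} - {q}. A q * A s * \<rho> (int q - int s))"
      by (simp add: sum_negf)
  qed
  also have "\<dots> = (\<Sum>q<p. \<Sum>s<p. A q * A s * \<rho> (int q - int s))"
  proof (intro sum.cong refl)
    fix q assume "q \<in> {..<p}"
    then show "2 * (A q)\<^sup>2 + (\<Sum>s\<in>{..<p} - {q}. A q * A s * \<rho> (int q - int s)) = (\<Sum>s<p. A q * A s * \<rho> (int q - int s))"
      by (subst sum.remove[of "{..<p}" q]) (auto simp: \<rho>_def fgn_cov_0 power2_eq_square)
  qed
  finally have "(\<Sum>q<p. (A q)\<^sup>2 * (2 - off q)) \<le> 2 * filter_cov H p a 0"
    unfolding filter_cov_by_parts[OF a0] by (simp add: A_def \<rho>_def)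
  moreover have "0 < (\<Sum>q<p. (A q)\<^sup>2 * (2 - off q))"
  proof -
    obtain q where "q < p" "A q \<noteq> 0"
      using diff_filter_partial_sum_nonzero[OF a] by (auto simp: A_def)
    then show ?thesis
      using off by (intro sum_pos2[of _ q]) (auto simp: less_imp_le)
  qed
  ultimately show ?thesis by simp
qed

text \<open>For each pair of weights the lags run over a translate of \<open>F\<close>, on which the
  absolute values of \<open>fgn_cov\<close> sum to at most 4; the factor 1/2 in
  \<open>filter_cov_by_parts\<close> leaves 2.\<close>

lemma sum_abs_filter_cov_le:
  assumes H: "0 < H" "H < 1/2" and a: "(\<Sum>i\<le>p. a i) = 0" and F: "finite F"
  shows "(\<Sum>d\<in>F. \<bar>filter_cov H p a d\<bar>) \<le> 2 * (\<Sum>q<p. \<bar>\<Sum>i\<le>q. a i\<bar>)\<^sup>2"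
proof -
  define A where "A q = (\<Sum>i\<le>q. a i)" for q
  have b: "0 < 2 * H" "2 * H < 1" using H by auto
  have "(\<Sum>d\<in>F. \<bar>filter_cov H p a d\<bar>) \<le> (\<Sum>d\<in>F. (\<Sum>q<p. \<Sum>s<p. \<bar>A q\<bar> * \<bar>A s\<bar> * \<bar>fgn_cov (2 * H) (int q - int s + d)\<bar>) / 2)"
  proof (rule sum_mono)
    fix d
    have "\<bar>\<Sum>q<p. \<Sum>s<p. A q * A s * fgn_cov (2 * H) (int q - int s + d)\<bar>
        \<le> (\<Sum>q<p. \<bar>\<Sum>s<p. A q * A s * fgn_cov (2 * H) (int q - int s + d)\<bar>)"
      by (rule sum_abs)
    also have "\<dots> \<le> (\<Sum>q<p. \<Sum>s<p. \<bar>A q * A s * fgn_cov (2 * H) (int q - int s + d)\<bar>)"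
      by (intro sum_mono sum_abs)
    finally show "\<bar>filter_cov H p a d\<bar> \<le> (\<Sum>q<p. \<Sum>s<p. \<bar>A q\<bar> * \<bar>A s\<bar> * \<bar>fgn_cov (2 * H) (int q - int s + d)\<bar>) / 2"
      unfolding filter_cov_by_parts[OF a] by (simp add: A_def abs_mult)
  qed
  also have "\<dots> = (\<Sum>q<p. \<Sum>d\<in>F. \<Sum>s<p. \<bar>A q\<bar> * \<bar>A s\<bar> * \<bar>fgn_cov (2 * H) (int q - int s + d)\<bar>) / 2"
    unfolding sum_divide_distrib[symmetric] by (subst sum.swap) simp
  also have "\<dots> = (\<Sum>q<p. \<Sum>s<p. \<Sum>d\<in>F. \<bar>A q\<bar> * \<bar>A s\<bar> * \<bar>fgn_cov (2 * H) (int q - int s + d)\<bar>) / 2"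
    by (subst (2) sum.swap) simp
  also have "\<dots> \<le> (\<Sum>q<p. \<Sum>s<p. \<bar>A q\<bar> * \<bar>A s\<bar> * 4) / 2"
  proof (intro divide_right_mono sum_mono)
    fix q s
    have "(\<Sum>d\<in>F. \<bar>fgn_cov (2 * H) (int q - int s + d)\<bar>) = (\<Sum>m\<in>(\<lambda>d. int q - int s + d) ` F. \<bar>fgn_cov (2 * H) m\<bar>)"
      by (subst sum.reindex) (auto simp: inj_on_def)
    also have "\<dots> \<le> 4" using F by (intro sum_abs_fgn_cov_le[OF b]) auto
    finally show "(\<Sum>d\<in>F. \<bar>A q\<bar> * \<bar>A s\<bar> * \<bar>fgn_cov (2 * H) (int q - int s + d)\<bar>) \<le> \<bar>A q\<bar> * \<bar>A s\<bar> * 4"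
      unfolding sum_distrib_left[symmetric] by (intro mult_left_mono) auto
  qed auto
  also have "\<dots> = 2 * (\<Sum>q<p. \<bar>A q\<bar>)\<^sup>2"
  proof -
    have "(\<Sum>q<p. \<Sum>s<p. \<bar>A q\<bar> * \<bar>A s\<bar> * 4) = (\<Sum>q<p. \<bar>A q\<bar>) * (\<Sum>s<p. \<bar>A s\<bar>) * 4"
      by (simp only: sum_product[where A = "{..<p}" and B = "{..<p}"] sum_distrib_right[of _ _ 4])
    then show ?thesis by (simp add: power2_eq_square)
  qed
  finally show ?thesis by (simp add: A_def)
qed

section \<open>Averages of Toeplitz sums and the limit variance\<close>

lemma cesaro_mean:
  fixes u :: "nat \<Rightarrow> real"
  assumes u: "u \<longlonglongrightarrow> L"
  shows "(\<lambda>n. (\<Sum>k<n. u k) / real n) \<longlonglongrightarrow> L"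
proof (rule LIMSEQ_I)
  fix e :: real assume e: "0 < e"
  obtain m where m: "\<And>k. m \<le> k \<Longrightarrow> \<bar>u k - L\<bar> < e / 2"
    using LIMSEQ_D[OF u, of "e / 2"] e by auto
  define S where "S = (\<Sum>k<m. \<bar>u k - L\<bar>)"
  obtain n0 where n0: "2 * S / e < real n0" using reals_Archimedean2 by blast
  have "norm ((\<Sum>k<n. u k) / real n - L) < e" if n: "Suc (max m n0) \<le> n" for n
  proof -
    have n': "0 < n" "m \<le> n" "n0 \<le> n" using n by auto
    have "\<bar>\<Sum>k<n. u k - L\<bar> \<le> (\<Sum>k<n. \<bar>u k - L\<bar>)" by (rule sum_abs)
    also have "\<dots> = S + (\<Sum>k=m..<n. \<bar>u k - L\<bar>)"
      using n' unfolding S_def lessThan_atLeast0 by (intro sum.atLeastLessThan_concat[symmetric]) auto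
    also have "(\<Sum>k=m..<n. \<bar>u k - L\<bar>) \<le> (\<Sum>k=m..<n. e / 2)"
      using m by (intro sum_mono) (auto intro: less_imp_le)
    also have "\<dots> \<le> real n * (e / 2)"
      using e by (simp add: mult_right_mono)
    finally have 1: "\<bar>\<Sum>k<n. u k - L\<bar> \<le> S + real n * (e / 2)" by simp
    have "2 * S / e < real n" using n0 n' by (meson of_nat_le_iff less_le_trans)
    then have "S < real n * (e / 2)" using e by (simp add: field_simps)
    with 1 have "\<bar>\<Sum>k<n. u k - L\<bar> < real n * e" by simp
    moreover have "(\<Sum>k<n. u k) / real n - L = (\<Sum>k<n. u k - L) / real n"
      using n' by (simp add: sum_subtractf field_simps)
    ultimately show ?thesis using n' by (simp add: abs_divide divide_less_eq mult.commute)
  qed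
  then show "\<exists>no. \<forall>n\<ge>no. norm ((\<Sum>k<n. u k) / real n - L) < e" by blast
qed

text \<open>Enlarging the square from n to n + 1 adds the corner and, by symmetry, twice the sum
  over the lags 1 to n; the quotient is therefore a Cesaro mean of a convergent sequence.\<close>

lemma toeplitz_sum_mean:
  fixes c :: "int \<Rightarrow> real"
  assumes sym: "\<And>m. c (- m) = c m" and sums: "(\<lambda>d. c (int (Suc d))) sums s"
  shows "(\<lambda>n. (\<Sum>i<n. \<Sum>j<n. c (int i - int j)) / real n) \<longlonglongrightarrow> c 0 + 2 * s"
proof -
  have "(\<Sum>i<n. \<Sum>j<n. c (int i - int j)) = (\<Sum>k<n. c 0 + 2 * (\<Sum>d<k. c (int (Suc d))))" for n
  proof (induction n)
    case (Suc n)
    have r: "(\<Sum>j<n. c (int n - int j)) = (\<Sum>d<n. c (int (Suc d)))"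
      by (rule sum.reindex_bij_witness[of _ "\<lambda>d. n - Suc d" "\<lambda>j. n - Suc j"]) (auto simp: of_nat_diff)
    have r': "(\<Sum>i<n. c (int i - int n)) = (\<Sum>j<n. c (int n - int j))"
      using sym[of "int _ - int n"] by (intro sum.cong) auto
    show ?case using Suc.IH by (simp add: sum.distrib r' r distrib_right)
  qed simp
  moreover have "(\<lambda>k. c 0 + 2 * (\<Sum>d<k. c (int (Suc d)))) \<longlonglongrightarrow> c 0 + 2 * s"
    using sums unfolding sums_def by (intro tendsto_intros)
  ultimately show ?thesis using cesaro_mean by simp
qed

text \<open>Twice the sum of the squared correlations over all integer lags: lag 0 gives 2, and each
  pair of opposite lags gives 4 times a square.\<close>

definition quad_var_limit :: "real \<Rightarrow> nat \<Rightarrow> (nat \<Rightarrow> real) \<Rightarrow> real" where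
  "quad_var_limit H p a = 2 + 4 * (\<Sum>d. (filter_cov H p a (int (Suc d)) / filter_cov H p a 0)\<^sup>2)"

text \<open>The absolute correlations have finite sums at most \<open>R\<close>, so each is at most
  \<open>R\<close> and the squares over positive lags sum to at most \<open>R * R\<close>.\<close>

lemma filter_correlation_square_mean:
  assumes H: "0 < H" "H < 1/2" and a: "is_diff_filter p a"
  defines "r \<equiv> \<lambda>d. filter_cov H p a d / filter_cov H p a 0"
  shows "0 < quad_var_limit H p a"
    and "(\<lambda>n. (\<Sum>i<n - p. \<Sum>j<n - p. (r (int i - int j))\<^sup>2) / real n) \<longlonglongrightarrow> quad_var_limit H p a / 2"
proof -
  have a0: "(\<Sum>i\<le>p. a i) = 0" using a by (simp add: is_diff_filter_def)
  note pos = filter_cov_0_pos[OF H a]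
  define R where "R = 2 * (\<Sum>q<p. \<bar>\<Sum>i\<le>q. a i\<bar>)\<^sup>2 / filter_cov H p a 0"
  have R: "(\<Sum>d\<in>F. \<bar>r d\<bar>) \<le> R" if "finite F" for F
    using sum_abs_filter_cov_le[OF H a0 that] pos
    by (simp add: r_def R_def abs_divide divide_right_mono flip: sum_divide_distrib)
  have R1: "\<bar>r d\<bar> \<le> R" for d using R[of "{d}"] by simp
  have "summable (\<lambda>d. (r (int (Suc d)))\<^sup>2)"
  proof (rule summableI_nonneg_bounded)
    fix n
    have "(\<Sum>d<n. (r (int (Suc d)))\<^sup>2) \<le> (\<Sum>d<n. R * \<bar>r (int (Suc d))\<bar>)"
    proof (rule sum_mono)
      fix d
      have "(r (int (Suc d)))\<^sup>2 = \<bar>r (int (Suc d))\<bar> * \<bar>r (int (Suc d))\<bar>"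
        by (simp add: power2_eq_square)
      also have "\<dots> \<le> R * \<bar>r (int (Suc d))\<bar>"
        by (rule mult_right_mono[OF R1]) simp
      finally show "(r (int (Suc d)))\<^sup>2 \<le> R * \<bar>r (int (Suc d))\<bar>" .
    qed
    also have "\<dots> = R * (\<Sum>d\<in>(\<lambda>d. int (Suc d)) ` {..<n}. \<bar>r d\<bar>)"
      by (subst sum.reindex) (auto simp: inj_on_def sum_distrib_left)
    also have "\<dots> \<le> R * R"
      using R1[of 0] by (intro mult_left_mono R) auto
    finally show "(\<Sum>d<n. (r (int (Suc d)))\<^sup>2) \<le> R * R" .
  qed simp
  then obtain s where s: "(\<lambda>d. (r (int (Suc d)))\<^sup>2) sums s" by (auto simp: summable_def)
  have s0: "0 \<le> s" using sums_le[OF _ sums_zero s] by simp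
  define T where "T n = (\<Sum>i<n. \<Sum>j<n. (r (int i - int j))\<^sup>2)" for n
  have "(\<lambda>n. T n / real n) \<longlonglongrightarrow> (r 0)\<^sup>2 + 2 * s"
    unfolding T_def using s by (intro toeplitz_sum_mean[of "\<lambda>d. (r d)\<^sup>2"]) (simp_all add: r_def filter_cov_minus)
  then have T: "(\<lambda>n. T n / real n) \<longlonglongrightarrow> 1 + 2 * s" using pos by (simp add: r_def)
  \<comment> \<open>The matrix has size \<open>n - p\<close> but the divisor is n; after a shift by
    \<open>p\<close> the discrepancy is a factor that tends to 1.\<close>
  have lim: "(\<lambda>n. T (n - p) / real n) \<longlonglongrightarrow> 1 + 2 * s"
  proof (rule LIMSEQ_offset[of _ p])
    have "(\<lambda>n. T n / real n * (real n / real (n + p))) \<longlonglongrightarrow> (1 + 2 * s) * 1"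
      by (intro tendsto_mult T) real_asymp
    moreover have "T n / real n * (real n / real (n + p)) = T (n + p - p) / real (n + p)" for n
      by (cases "n = 0") (simp_all add: T_def)
    ultimately show "(\<lambda>n. T (n + p - p) / real (n + p)) \<longlonglongrightarrow> 1 + 2 * s"
      by (simp only: mult_1_right)
  qed
  have v: "quad_var_limit H p a = 2 * (1 + 2 * s)"
    using sums_unique[OF s] by (simp add: quad_var_limit_def r_def)
  show "0 < quad_var_limit H p a" using s0 by (simp add: v)
  show "(\<lambda>n. (\<Sum>i<n - p. \<Sum>j<n - p. (r (int i - int j))\<^sup>2) / real n) \<longlonglongrightarrow> quad_var_limit H p a / 2"
    using lim by (simp only: v T_def nonzero_mult_div_cancel_left[OF zero_neq_numeral[symmetric]])
qed

section \<open>Fractional Brownian motion\<close>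

lemma fBm_prob_space: "fBm M H B \<Longrightarrow> prob_space M"
  by (simp add: fBm_def)

text \<open>Distinct indices may share a time, as overlapping filter differences do, while
  \<open>gaussian_process\<close> takes sums over sets of times; the coefficients are therefore
  collected time by time.\<close>

lemma fBm_gaussian_combination:
  assumes B: "fBm M H B" and I: "finite I" and \<tau>: "\<And>i. i \<in> I \<Longrightarrow> 0 \<le> \<tau> i"
  shows "gaussian_rv M (\<lambda>\<omega>. \<Sum>i\<in>I. c i * B (\<tau> i) \<omega>)"
proof -
  have "(\<Sum>i\<in>I. c i * B (\<tau> i) \<omega>) = (\<Sum>t\<in>\<tau> ` I. (\<Sum>i\<in>{i\<in>I. \<tau> i = t}. c i) * B t \<omega>)" for \<omega>
    by (subst sum.image_gen[OF I, of _ \<tau>]) (auto simp: sum_distrib_right intro!: sum.cong)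
  then show ?thesis
    using fBm_gaussian_sum[OF B, of "\<tau> ` I" "\<lambda>t. \<Sum>i\<in>{i\<in>I. \<tau> i = t}. c i"] I \<tau> by auto
qed

lemma fBm_measurable:
  assumes "fBm M H B" "0 \<le> t"
  shows "B t \<in> borel_measurable M"
  using fBm_gaussian_combination[OF assms(1), of "{()}" "\<lambda>_. t" "\<lambda>_. 1"] assms(2)
  by (simp add: gaussian_rv_def)

lemma fBm_filter_diff_gaussian:
  fixes N :: nat
  assumes B: "fBm M H B" and "0 \<le> \<Delta>"
  shows "gaussian_rv M (\<lambda>\<omega>. \<Sum>j<N. c j * filter_diff p a \<Delta> B (m j) \<omega>)"
proof -
  have "(\<Sum>j<N. c j * filter_diff p a \<Delta> B (m j) \<omega>)
      = (\<Sum>(j, i)\<in>{..<N} \<times> {..p}. (c j * a i) * B (real (i + m j) * \<Delta>) \<omega>)" for \<omega>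
    by (simp add: filter_diff_def sum.cartesian_product[symmetric] sum_distrib_left mult.assoc)
  then show ?thesis
    using fBm_gaussian_combination[OF B, of "{..<N} \<times> {..p}" "\<lambda>(j, i). real (i + m j) * \<Delta>" "\<lambda>(j, i). c j * a i"] assms
    by (simp add: case_prod_unfold)
qed

lemma fBm_filter_diff_integrable:
  assumes B: "fBm M H B" and \<Delta>: "0 \<le> \<Delta>"
  shows "integrable M (filter_diff p a \<Delta> B j)"
    and "integrable M (\<lambda>\<omega>. filter_diff p a \<Delta> B j \<omega> * filter_diff p a \<Delta> B k \<omega>)"
proof -
  have \<tau>: "0 \<le> real (i + j) * \<Delta>" for i j :: nat using \<Delta> by simp
  note int = fBm_integrable[OF B \<tau> \<tau>]
  show "integrable M (filter_diff p a \<Delta> B j)"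
    unfolding filter_diff_def using int(2)
    by (intro Bochner_Integration.integrable_sum integrable_mult_right) auto
  show "integrable M (\<lambda>\<omega>. filter_diff p a \<Delta> B j \<omega> * filter_diff p a \<Delta> B k \<omega>)"
  proof -
    have "filter_diff p a \<Delta> B j \<omega> * filter_diff p a \<Delta> B k \<omega>
      = (\<Sum>i\<le>p. \<Sum>l\<le>p. a i * a l * (B (real (i + j) * \<Delta>) \<omega> * B (real (l + k) * \<Delta>) \<omega>))" for \<omega>
      by (simp add: filter_diff_def sum_product mult_ac)
    then show ?thesis
      using int(1) by (auto intro!: Bochner_Integration.integrable_sum integrable_mult_right)
  qed
qed

lemma fBm_filter_diff_mean:
  assumes B: "fBm M H B" and \<Delta>: "0 \<le> \<Delta>"
  shows "prob_space.expectation M (filter_diff p a \<Delta> B j) = 0"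
proof -
  have \<tau>: "0 \<le> real (i + j) * \<Delta>" for i j :: nat using \<Delta> by simp
  have "prob_space.expectation M (B (real (i + j) * \<Delta>)) = 0" for i
    using B \<tau>[of i j] unfolding fBm_def by blast
  then show ?thesis
    unfolding filter_diff_def using fBm_integrable(2)[OF B \<tau> \<tau>] by simp
qed

lemma fBm_filter_diff_cov:
  assumes B: "fBm M H B" and a: "(\<Sum>q\<le>p. a q) = 0" and \<Delta>: "0 < \<Delta>"
  shows "prob_space.expectation M (\<lambda>\<omega>. filter_diff p a \<Delta> B i \<omega> * filter_diff p a \<Delta> B j \<omega>)
    = \<Delta> powr (2 * H) * filter_cov H p a (int i - int j)"
proof -
  interpret prob_space M using B by (rule fBm_prob_space)
  define \<tau> where "\<tau> n k = real (k + n) * \<Delta>" for n k :: nat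
  have \<tau>: "0 \<le> \<tau> n k" for n k using \<Delta> by (simp add: \<tau>_def)
  define h where "h x = \<bar>x\<bar> powr (2 * H)" for x :: real
  have cov: "expectation (\<lambda>\<omega>. B (\<tau> i k) \<omega> * B (\<tau> j l) \<omega>) =
      (h (\<tau> i k) + h (\<tau> j l) - h (\<tau> i k - \<tau> j l)) / 2" for k l
    using B \<tau>[of i k] \<tau>[of j l] unfolding fBm_def h_def by auto
  have diff: "h (\<tau> i k - \<tau> j l) = \<Delta> powr (2 * H) * h (of_int (int k - int l + (int i - int j)))" for k l
  proof -
    have "\<tau> i k - \<tau> j l = \<Delta> * of_int (int k - int l + (int i - int j))" by (simp add: \<tau>_def algebra_simps)
    then show ?thesis using \<Delta> by (simp add: h_def abs_mult powr_mult)
  qed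
  have "expectation (\<lambda>\<omega>. filter_diff p a \<Delta> B i \<omega> * filter_diff p a \<Delta> B j \<omega>)
      = expectation (\<lambda>\<omega>. \<Sum>k\<le>p. \<Sum>l\<le>p. a k * a l * (B (\<tau> i k) \<omega> * B (\<tau> j l) \<omega>))"
    by (simp add: filter_diff_def \<tau>_def sum_product mult_ac)
  also have "\<dots> = (\<Sum>k\<le>p. \<Sum>l\<le>p. a k * a l * expectation (\<lambda>\<omega>. B (\<tau> i k) \<omega> * B (\<tau> j l) \<omega>))"
    using fBm_integrable(1)[OF B \<tau> \<tau>] by (simp add: Bochner_Integration.integral_sum)
  also have "\<dots> = (\<Sum>k\<le>p. \<Sum>l\<le>p. (a k * h (\<tau> i k) / 2) * a l + a k * (a l * h (\<tau> j l) / 2)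
      - (\<Delta> powr (2 * H) / 2) * (a k * a l * h (of_int (int k - int l + (int i - int j)))))"
    unfolding cov diff by (intro sum.cong refl) (simp add: field_simps)
  also have "\<dots> = (\<Sum>k\<le>p. a k * h (\<tau> i k) / 2) * (\<Sum>l\<le>p. a l)
      + (\<Sum>k\<le>p. a k) * (\<Sum>l\<le>p. a l * h (\<tau> j l) / 2)
      - (\<Delta> powr (2 * H) / 2) * (\<Sum>k\<le>p. \<Sum>l\<le>p. a k * a l * h (of_int (int k - int l + (int i - int j))))"
    by (simp only: sum.distrib sum_subtractf sum_product sum_distrib_left[of "\<Delta> powr (2 * H) / 2"])
  also have "\<dots> = \<Delta> powr (2 * H) * filter_cov H p a (int i - int j)"
    unfolding a filter_cov_def h_def by simp
  finally show ?thesis .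
qed

lemma quad_var_eq:
  assumes "0 < \<Delta>" "0 < filter_cov H p a 0"
  shows "sqrt (real n) * quad_var H p a n \<Delta> Z \<omega>
    = (\<Sum>j<n - p. (filter_diff p a \<Delta> Z (Suc j) \<omega> / sqrt (filter_var H p a \<Delta>))\<^sup>2 - 1) / sqrt (real n)"
proof -
  have "0 < filter_var H p a \<Delta>" using assms by (simp add: filter_var_eq_filter_cov)
  then have "(\<Sum>j<n - p. (filter_diff p a \<Delta> Z (Suc j) \<omega> / sqrt (filter_var H p a \<Delta>))\<^sup>2 - 1)
     = (\<Sum>j = 1..n - p. (filter_diff p a \<Delta> Z j \<omega>)\<^sup>2 / filter_var H p a \<Delta> - 1)"
    unfolding power_divide by (simp add: sum.atLeast1_atMost_eq)
  moreover have "sqrt (real n) * (1 / real n) = 1 / sqrt (real n)"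
    using sqrt_divide_self_eq[of "real n"] by (simp add: divide_inverse)
  ultimately show ?thesis
    unfolding quad_var_def mult.assoc[symmetric] by simp
qed

theorem fBm_quad_var_clt:
  assumes H: "0 < H" "H < 1/2" and a: "is_diff_filter p a" and B: "fBm M H B"
  shows "conv_in_distr M (\<lambda>n \<omega>. sqrt (real n) * quad_var H p a n (real n powr (- \<alpha>)) B \<omega>)
    (centered_normal (quad_var_limit H p a))"
proof -
  have a0: "(\<Sum>i\<le>p. a i) = 0" using a by (simp add: is_diff_filter_def)
  note pos = filter_cov_0_pos[OF H a]
  define r where "r d = filter_cov H p a d / filter_cov H p a 0" for d
  define \<Delta> where "\<Delta> n = real n powr (- \<alpha>)" for n :: nat
  have \<Delta>0: "0 \<le> \<Delta> n" for n by (simp add: \<Delta>_def)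
  have \<Delta>: "0 < \<Delta> n" if "0 < n" for n using that by (simp add: \<Delta>_def)
  define \<sigma> where "\<sigma> n = filter_var H p a (\<Delta> n)" for n
  have \<sigma>: "0 < \<sigma> n" if "0 < n" for n
    using \<Delta>[OF that] pos by (simp add: \<sigma>_def filter_var_eq_filter_cov)
  define \<xi> where "\<xi> n j \<omega> = filter_diff p a (\<Delta> n) B (Suc j) \<omega> / sqrt (\<sigma> n)" for n j \<omega>
  have "conv_in_distr M (\<lambda>n \<omega>. (\<Sum>j<n - p. (\<xi> n j \<omega>)\<^sup>2 - 1) / sqrt (real n)) (centered_normal (quad_var_limit H p a))"
  \<comment> \<open>Along a row the lags are distinct, so one bound on sums over finite sets of lags
    serves as \<open>R\<close> for every n.\<close>
  proof (rule gaussian_square_sum_clt[where \<Gamma> = "\<lambda>n i j. r (int i - int j)" and N = "\<lambda>n. n - p"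
        and R = "2 * (\<Sum>q<p. \<bar>\<Sum>i\<le>q. a i\<bar>)\<^sup>2 / filter_cov H p a 0"])
    show "prob_space M" using B by (rule fBm_prob_space)
    show "gaussian_rv M (\<lambda>\<omega>. \<Sum>j<n - p. c j * \<xi> n j \<omega>)" for n c
      using fBm_filter_diff_gaussian[OF B \<Delta>0, where N = "n - p" and c = "\<lambda>j. c j / sqrt (\<sigma> n)" and m = Suc]
      by (simp add: \<xi>_def)
    show "integrable M (\<xi> n j)" for n j
      unfolding \<xi>_def using fBm_filter_diff_integrable(1)[OF B \<Delta>0] by (intro integrable_divide_zero) auto
    show "integrable M (\<lambda>\<omega>. \<xi> n i \<omega> * \<xi> n j \<omega>)" for n i j
      unfolding \<xi>_def times_divide_times_eq
      using fBm_filter_diff_integrable(2)[OF B \<Delta>0] by (intro integrable_divide_zero) auto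
    show "prob_space.expectation M (\<xi> n j) = 0" for n j
      unfolding \<xi>_def using fBm_filter_diff_mean[OF B \<Delta>0] by simp
    show "prob_space.expectation M (\<lambda>\<omega>. \<xi> n i \<omega> * \<xi> n j \<omega>) = r (int i - int j)" if n: "0 < n" for n i j
      unfolding \<xi>_def times_divide_times_eq
      using fBm_filter_diff_cov[OF B a0 \<Delta>[OF n]] \<sigma>[OF n] \<Delta>[OF n]
      by (simp add: \<sigma>_def filter_var_eq_filter_cov r_def)
    show "(\<Sum>j<n - p. \<bar>r (int i - int j)\<bar>) \<le> 2 * (\<Sum>q<p. \<bar>\<Sum>i\<le>q. a i\<bar>)\<^sup>2 / filter_cov H p a 0" for n i
    proof -
      have "(\<Sum>j<n - p. \<bar>filter_cov H p a (int i - int j)\<bar>)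
          = (\<Sum>d\<in>(\<lambda>j. int i - int j) ` {..<n - p}. \<bar>filter_cov H p a d\<bar>)"
        by (subst sum.reindex) (auto simp: inj_on_def)
      also have "\<dots> \<le> 2 * (\<Sum>q<p. \<bar>\<Sum>i\<le>q. a i\<bar>)\<^sup>2"
        by (rule sum_abs_filter_cov_le[OF H a0]) simp
      finally show ?thesis
        using pos by (simp add: r_def abs_divide divide_right_mono flip: sum_divide_distrib)
    qed
    show "r (int i - int i) = 1" for i using pos by (simp add: r_def)
  qed (use filter_correlation_square_mean[OF H a] in \<open>simp_all add: r_def\<close>)
  moreover have "(\<Sum>j<n - p. (\<xi> n j \<omega>)\<^sup>2 - 1) / sqrt (real n)
      = sqrt (real n) * quad_var H p a n (real n powr (- \<alpha>)) B \<omega>" for n \<omega>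
  \<comment> \<open>For n = 0 the mesh size \<open>0 powr (- \<alpha>)\<close> is 0, so
    \<open>quad_var_eq\<close> does not apply; both sides are then 0.\<close>
  proof (cases "n = 0")
    case False
    then show ?thesis
      using quad_var_eq[of "\<Delta> n" H p a n B \<omega>] \<Delta>[of n] pos by (simp add: \<xi>_def \<sigma>_def \<Delta>_def)
  qed simp
  ultimately show ?thesis by simp
qed

section \<open>Identification of \<open>clt_variance\<close>\<close>

lemma gaussian_rv_distrI:
  assumes [measurable]: "T \<in> measurable M N" "Y \<in> borel_measurable N"
    and g: "gaussian_rv M (\<lambda>\<omega>. Y (T \<omega>))"
  shows "gaussian_rv (distr M N T) Y"
proof -
  have "(AE w in distr M N T. Y w = \<mu>) \<longleftrightarrow> (AE \<omega> in M. Y (T \<omega>) = \<mu>)" for \<mu>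
    by (intro AE_distr_iff) auto
  moreover have "distr (distr M N T) lborel Y = distr M lborel (\<lambda>\<omega>. Y (T \<omega>))"
    by (subst distr_distr) (auto simp: comp_def)
  ultimately show ?thesis
    using g by (auto simp: gaussian_rv_def distributed_def)
qed

text \<open>\<open>fBm\<close> constrains finite-dimensional laws only, so it passes to the image of
  M under the path map, with the coordinates as the process.\<close>

lemma fBm_path_space:
  assumes B: "fBm M H B"
  obtains M' :: "(real \<Rightarrow> real) measure" and B' where "fBm M' H B'"
proof -
  interpret prob_space M using B by (rule fBm_prob_space)
  \<comment> \<open>Negative times are set to 0: nothing is known about \<open>B t\<close> there,
    not even measurability.\<close>
  define T where "T \<omega> = (\<lambda>t. if 0 \<le> t then B t \<omega> else 0)" for \<omega>
  define P where "P = (PiM UNIV (\<lambda>_. borel) :: (real \<Rightarrow> real) measure)"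
  have [measurable]: "B t \<in> borel_measurable M" if "0 \<le> t" for t
    using fBm_measurable[OF B that] .
  have T [measurable]: "T \<in> measurable M P"
    unfolding P_def
  proof (rule measurable_PiM_single')
    show "(\<lambda>\<omega>. T \<omega> t) \<in> borel_measurable M" for t
      by (cases "0 \<le> t") (simp_all add: T_def)
  qed simp
  have [measurable]: "(\<lambda>w. w t) \<in> borel_measurable P" for t
    unfolding P_def by measurable
  define B' where "B' t w = w t" for t and w :: "real \<Rightarrow> real"
  have BT: "B' t (T \<omega>) = B t \<omega>" if "0 \<le> t" for t \<omega> using that by (simp add: B'_def T_def)
  have [measurable]: "B' t \<in> borel_measurable P" for t unfolding B'_def by measurable
  have "gaussian_rv (distr M P T) (\<lambda>w. \<Sum>t\<in>J. c t * B' t w)" if "finite J" "J \<subseteq> {0..}" for J c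
  proof (rule gaussian_rv_distrI[OF T])
    have "(\<Sum>t\<in>J. c t * B' t (T \<omega>)) = (\<Sum>t\<in>J. c t * B t \<omega>)" for \<omega>
      using that by (intro sum.cong refl) (auto simp: BT)
    then show "gaussian_rv M (\<lambda>\<omega>. \<Sum>t\<in>J. c t * B' t (T \<omega>))"
      using fBm_gaussian_sum[OF B that] by simp
  qed measurable
  then have "fBm (distr M P T) H B'"
    using B unfolding fBm_def gaussian_process_def
    by (auto simp: integral_distr BT prob_space_distr)
  then show ?thesis by (rule that)
qed

lemma clt_variance_eq:
  assumes H: "0 < H" "H < 1/2" and a: "is_diff_filter p a" and B: "fBm M H B"
  shows "clt_variance H p a = quad_var_limit H p a"
  unfolding clt_variance_def
proof (rule the_equality)
  show "0 < quad_var_limit H p a \<and> (\<forall>(M :: (real \<Rightarrow> real) measure) B \<alpha>. fBm M H B \<and> 0 < \<alpha> \<longrightarrow>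
      conv_in_distr M (\<lambda>n \<omega>. sqrt (real n) * quad_var H p a n (real n powr - \<alpha>) B \<omega>) (centered_normal (quad_var_limit H p a)))"
    using filter_correlation_square_mean(1)[OF H a] fBm_quad_var_clt[OF H a] by blast
  fix v
  assume v: "0 < v \<and> (\<forall>(M :: (real \<Rightarrow> real) measure) B \<alpha>. fBm M H B \<and> 0 < \<alpha> \<longrightarrow>
      conv_in_distr M (\<lambda>n \<omega>. sqrt (real n) * quad_var H p a n (real n powr - \<alpha>) B \<omega>) (centered_normal v))"
  obtain M' :: "(real \<Rightarrow> real) measure" and B' where B': "fBm M' H B'"
    using fBm_path_space[OF B] by blast
  \<comment> \<open>Any positive exponent would serve; 1 is taken. Along this one sequence the two
    normal limits are compared.\<close>
  define Y where "Y n \<omega> = sqrt (real n) * quad_var H p a n (real n powr (- 1)) B' \<omega>" for n \<omega>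
  have M': "prob_space M'" using B' by (rule fBm_prob_space)
  have [measurable]: "B' t \<in> borel_measurable M'" if "0 \<le> t" for t
    using fBm_measurable[OF B' that] .
  have [measurable]: "Y n \<in> borel_measurable M'" for n
    unfolding Y_def quad_var_def filter_diff_def by measurable
  have "conv_in_distr M' Y (centered_normal v)"
    unfolding Y_def by (rule v[THEN conjunct2, rule_format]) (use B' in simp)
  then have 1: "(\<lambda>n. LINT \<omega>|M'. iexp (t * Y n \<omega>)) \<longlonglongrightarrow> complex_of_real (exp (- (v * t\<^sup>2) / 2))" for t
    using conv_in_distr_normal_iff[of M' Y v] M' v[THEN conjunct1] by simp
  have pos: "0 < quad_var_limit H p a"
    by (rule filter_correlation_square_mean(1)[OF H a])
  have "conv_in_distr M' Y (centered_normal (quad_var_limit H p a))"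
    unfolding Y_def by (rule fBm_quad_var_clt[OF H a B'])
  then have 2: "(\<lambda>n. LINT \<omega>|M'. iexp (t * Y n \<omega>))
      \<longlonglongrightarrow> complex_of_real (exp (- (quad_var_limit H p a * t\<^sup>2) / 2))" for t
    using conv_in_distr_normal_iff[of M' Y "quad_var_limit H p a"] M' pos by simp
  have "exp (- (v * t\<^sup>2) / 2) = exp (- (quad_var_limit H p a * t\<^sup>2) / 2)" for t
    using LIMSEQ_unique[OF 1 2, of t] by (simp only: of_real_eq_iff)
  then show "v = quad_var_limit H p a"
    by (rule centered_normal_inj[OF v[THEN conjunct1] pos])
qed

section \<open>Perturbation by a bounded drift\<close>

lemma norm_iexp_diff_le: "cmod (iexp x - iexp y) \<le> \<bar>x - y\<bar>"
proof -
  have "iexp x - iexp y = iexp y * (iexp (x - y) - 1)"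
    by (simp add: right_diff_distrib algebra_simps flip: exp_add)
  then show ?thesis
    using iexp_approx1[of "x - y" 0] by (simp add: norm_mult del: of_real_diff)
qed

text \<open>\<open>iexp\<close> is Lipschitz with constant 1, so the characteristic functions at
  \<open>t\<close> differ by at most \<open>\<bar>t\<bar> * b n\<close>. With a majorant
  \<open>G\<close>, integrability has to be checked for \<open>G\<close> only; n = 0, where the mesh
  degenerates, is left out.\<close>

lemma conv_in_distr_normal_perturb:
  assumes M: "prob_space M"
    and meas: "\<And>n. U n \<in> borel_measurable M" "\<And>n. W n \<in> borel_measurable M"
    and v: "0 < v" and W: "conv_in_distr M W (centered_normal v)"
    and G: "\<And>n. 0 < n \<Longrightarrow> integrable M (G n)"
    and bnd: "\<And>n. 0 < n \<Longrightarrow> AE \<omega> in M. \<bar>U n \<omega> - W n \<omega>\<bar> \<le> G n \<omega>"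
    and EG: "\<And>n. 0 < n \<Longrightarrow> prob_space.expectation M (G n) \<le> b n" and b: "b \<longlonglongrightarrow> 0"
  shows "conv_in_distr M U (centered_normal v)"
proof -
  interpret prob_space M by fact
  note [measurable] = meas
  have int: "integrable M (\<lambda>\<omega>. iexp (t * Z \<omega>))" if [measurable]: "Z \<in> borel_measurable M" for Z t
    by (rule integrable_const_bound[of _ 1]) (auto simp del: of_real_mult)
  show ?thesis
  proof (subst conv_in_distr_normal_iff[OF M meas(1) v], intro allI)
    fix t
    have lim: "(\<lambda>n. LINT \<omega>|M. iexp (t * W n \<omega>)) \<longlonglongrightarrow> complex_of_real (exp (- (v * t\<^sup>2) / 2))"
      using W conv_in_distr_normal_iff[of M W, OF M meas(2) v] by blast
    have "(\<lambda>n. (LINT \<omega>|M. iexp (t * U n \<omega>)) - (LINT \<omega>|M. iexp (t * W n \<omega>))) \<longlonglongrightarrow> 0"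
    proof (rule Lim_null_comparison)
      show "(\<lambda>n. \<bar>t\<bar> * b n) \<longlonglongrightarrow> 0" using tendsto_mult_right_zero[OF b] .
      show "\<forall>\<^sub>F n in sequentially. cmod ((LINT \<omega>|M. iexp (t * U n \<omega>)) - (LINT \<omega>|M. iexp (t * W n \<omega>))) \<le> \<bar>t\<bar> * b n"
        using eventually_gt_at_top[of 0]
      proof eventually_elim
        case (elim n)
        have "(LINT \<omega>|M. iexp (t * U n \<omega>)) - (LINT \<omega>|M. iexp (t * W n \<omega>)) = (LINT \<omega>|M. iexp (t * U n \<omega>) - iexp (t * W n \<omega>))"
          by (intro Bochner_Integration.integral_diff[symmetric] int meas)
        also have "cmod \<dots> \<le> (LINT \<omega>|M. cmod (iexp (t * U n \<omega>) - iexp (t * W n \<omega>)))"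
          by (rule integral_norm_bound)
        also have "\<dots> \<le> (LINT \<omega>|M. \<bar>t\<bar> * G n \<omega>)"
        proof (rule integral_mono_AE)
          show "integrable M (\<lambda>\<omega>. cmod (iexp (t * U n \<omega>) - iexp (t * W n \<omega>)))"
            by (intro integrable_norm Bochner_Integration.integrable_diff int meas)
          show "integrable M (\<lambda>\<omega>. \<bar>t\<bar> * G n \<omega>)" using G[OF elim] by simp
          show "AE \<omega> in M. cmod (iexp (t * U n \<omega>) - iexp (t * W n \<omega>)) \<le> \<bar>t\<bar> * G n \<omega>"
            using bnd[OF elim]
          proof eventually_elim
            case (elim \<omega>)
            have "cmod (iexp (t * U n \<omega>) - iexp (t * W n \<omega>)) \<le> \<bar>t\<bar> * \<bar>U n \<omega> - W n \<omega>\<bar>"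
              using norm_iexp_diff_le[of "t * U n \<omega>" "t * W n \<omega>"] by (simp only: right_diff_distrib[symmetric] abs_mult)
            also have "\<dots> \<le> \<bar>t\<bar> * G n \<omega>" using elim by (intro mult_left_mono) auto
            finally show ?case .
          qed
        qed
        also have "\<dots> = \<bar>t\<bar> * expectation (G n)" by simp
        also have "\<dots> \<le> \<bar>t\<bar> * b n" using EG[OF elim] by (intro mult_left_mono) auto
        finally show ?case .
      qed
    qed
    from tendsto_add[OF this lim] show "(\<lambda>n. LINT \<omega>|M. iexp (t * U n \<omega>)) \<longlonglongrightarrow> complex_of_real (exp (- (v * t\<^sup>2) / 2))"
      by simp
  qed
qed

lemma set_integral_Icc_diff_le:
  fixes g :: "real \<Rightarrow> real"
  assumes int: "set_integrable lborel {0..t} g" and bnd: "\<And>s. 0 \<le> s \<Longrightarrow> \<bar>g s\<bar> \<le> K" and st: "0 \<le> s" "s \<le> t"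
  shows "\<bar>(LINT u:{0..t}|lborel. g u) - (LINT u:{0..s}|lborel. g u)\<bar> \<le> K * (t - s)"
proof -
  have un: "{0..t} = {0..s} \<union> {s<..t}" using st by auto
  have i1: "set_integrable lborel {0..s} g" and i2: "set_integrable lborel {s<..t} g"
    using st by (auto intro: set_integrable_subset[OF int])
  have "(LINT u:{0..t}|lborel. g u) - (LINT u:{0..s}|lborel. g u) = (LINT u:{s<..t}|lborel. g u)"
    unfolding un by (subst set_integral_Un[OF _ i1 i2]) auto
  also have "\<bar>\<dots>\<bar> \<le> (LINT u:{s<..t}|lborel. \<bar>g u\<bar>)"
    using set_integral_norm_bound[OF i2] by simp
  also have "\<dots> \<le> (LINT u:{s<..t}|lborel. K)"
  proof (rule set_integral_mono)
    show "set_integrable lborel {s<..t} (\<lambda>u. \<bar>g u\<bar>)" using i2 by (rule set_integrable_abs)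
    show "set_integrable lborel {s<..t} (\<lambda>u. K)" using st by (auto simp: set_integrable_def)
  qed (use bnd st in auto)
  also have "\<dots> = K * (t - s)"
    using st by (simp add: set_lebesgue_integral_def)
  finally show ?thesis .
qed

text \<open>As the coefficients sum to 0, the starting point \<open>x\<close> and the drift
  accumulated up to time \<open>j * \<Delta>\<close> drop out; what remains are drift integrals over
  intervals of length \<open>i * \<Delta>\<close>, which is why the bound is uniform in
  \<open>j\<close>.\<close>

lemma filter_diff_solution_bound:
  assumes a: "(\<Sum>q\<le>p. a q) = 0" and \<Delta>: "0 \<le> \<Delta>" and K: "\<And>s y. 0 \<le> s \<Longrightarrow> \<bar>f s y\<bar> \<le> K"
    and X: "\<forall>t\<ge>0. set_integrable lborel {0..t} (\<lambda>s. f s (X s \<omega>)) \<and>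
        X t \<omega> = x + (LINT s:{0..t}|lborel. f s (X s \<omega>)) + B t \<omega>"
  shows "\<bar>filter_diff p a \<Delta> X j \<omega> - filter_diff p a \<Delta> B j \<omega>\<bar> \<le> (\<Sum>i\<le>p. \<bar>a i\<bar> * (K * real i)) * \<Delta>"
proof -
  define D where "D t = (LINT s:{0..t}|lborel. f s (X s \<omega>))" for t
  have nn: "0 \<le> real (i + j) * \<Delta>" for i using \<Delta> by simp
  have XD: "X (real (i + j) * \<Delta>) \<omega> - B (real (i + j) * \<Delta>) \<omega> = x + D (real (i + j) * \<Delta>)" for i
    using X nn[of i] by (auto simp: D_def)
  have "filter_diff p a \<Delta> X j \<omega> - filter_diff p a \<Delta> B j \<omega> = (\<Sum>i\<le>p. a i * (x + D (real (i + j) * \<Delta>)))"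
    unfolding filter_diff_def sum_subtractf[symmetric] right_diff_distrib[symmetric] XD ..
  also have "\<dots> = (\<Sum>i\<le>p. a i * (D (real (i + j) * \<Delta>) - D (real j * \<Delta>)))
      + (\<Sum>i\<le>p. a i) * (x + D (real j * \<Delta>))"
    unfolding sum_distrib_right sum.distrib[symmetric] by (intro sum.cong refl) (simp add: algebra_simps)
  also have "\<dots> = (\<Sum>i\<le>p. a i * (D (real (i + j) * \<Delta>) - D (real j * \<Delta>)))"
    using a by simp
  also have "\<bar>\<dots>\<bar> \<le> (\<Sum>i\<le>p. \<bar>a i\<bar> * (K * real i * \<Delta>))"
  proof (rule order_trans[OF sum_abs], rule sum_mono)
    fix i
    have "\<bar>D (real (i + j) * \<Delta>) - D (real j * \<Delta>)\<bar> \<le> K * (real (i + j) * \<Delta> - real j * \<Delta>)"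
      unfolding D_def using X nn[of i] \<Delta> K
      by (intro set_integral_Icc_diff_le) (auto intro: mult_right_mono)
    also have "\<dots> = K * real i * \<Delta>" by (simp add: algebra_simps)
    finally show "\<bar>a i * (D (real (i + j) * \<Delta>) - D (real j * \<Delta>))\<bar> \<le> \<bar>a i\<bar> * (K * real i * \<Delta>)"
      unfolding abs_mult by (intro mult_left_mono) auto
  qed
  also have "\<dots> = (\<Sum>i\<le>p. \<bar>a i\<bar> * (K * real i)) * \<Delta>"
    by (simp add: sum_distrib_right mult.assoc)
  finally show ?thesis .
qed

text \<open>Cauchy-Schwarz against the constant 1, by way of
  \<open>\<bar>y\<bar> \<le> y * y / (2 * s) + s / 2\<close> with \<open>s\<close> the standard
  deviation, where both terms have expectation \<open>s / 2\<close>.\<close>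

lemma fBm_filter_diff_abs_mean:
  assumes B: "fBm M H B" and a: "(\<Sum>q\<le>p. a q) = 0" and \<Delta>: "0 < \<Delta>" and pos: "0 < filter_var H p a \<Delta>"
  shows "prob_space.expectation M (\<lambda>\<omega>. \<bar>filter_diff p a \<Delta> B j \<omega>\<bar>) \<le> sqrt (filter_var H p a \<Delta>)"
proof -
  interpret prob_space M using B by (rule fBm_prob_space)
  define s where "s = sqrt (filter_var H p a \<Delta>)"
  have s: "0 < s" "s * s = filter_var H p a \<Delta>" using pos by (simp_all add: s_def)
  note int = fBm_filter_diff_integrable[OF B less_imp_le[OF \<Delta>], of p a j]
  have sq: "expectation (\<lambda>\<omega>. filter_diff p a \<Delta> B j \<omega> * filter_diff p a \<Delta> B j \<omega>) = s * s"
    using fBm_filter_diff_cov[OF B a \<Delta>, of j j] by (simp add: s filter_var_eq_filter_cov)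
  have le: "\<bar>y\<bar> \<le> y * y / (2 * s) + s / 2" for y :: real
    using s sum_squares_bound[of "\<bar>y\<bar>" s] by (simp add: field_simps power2_eq_square)
  have "expectation (\<lambda>\<omega>. \<bar>filter_diff p a \<Delta> B j \<omega>\<bar>)
      \<le> expectation (\<lambda>\<omega>. filter_diff p a \<Delta> B j \<omega> * filter_diff p a \<Delta> B j \<omega> / (2 * s) + s / 2)"
    using int le by (intro integral_mono Bochner_Integration.integrable_add integrable_divide_zero) auto
  also have "\<dots> = s * s / (2 * s) + s / 2"
    using int by (subst Bochner_Integration.integral_add) (auto simp: sq prob_space intro: integrable_divide_zero)
  also have "\<dots> = s" using s(1) by (simp add: field_simps)
  finally show ?thesis by (simp add: s_def)
qed

text \<open>With \<open>d = x j - b j\<close> the difference of squares is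
  \<open>2 * d * b j + d\<^sup>2\<close>, so only the first absolute moment of the differences of
  \<open>B\<close> will be needed.\<close>

lemma quad_var_diff_bound:
  assumes \<sigma>: "0 < filter_var H p a \<Delta>" and n: "0 < n"
    and c: "\<And>j. \<bar>filter_diff p a \<Delta> X j \<omega> - filter_diff p a \<Delta> B j \<omega>\<bar> \<le> c * \<Delta>"
  shows "\<bar>sqrt (real n) * quad_var H p a n \<Delta> X \<omega> - sqrt (real n) * quad_var H p a n \<Delta> B \<omega>\<bar>
    \<le> (\<Sum>j=1..n - p. 2 * (c * \<Delta>) * \<bar>filter_diff p a \<Delta> B j \<omega>\<bar> + (c * \<Delta>)\<^sup>2) / (filter_var H p a \<Delta> * sqrt (real n))"
proof -
  define \<sigma>' where "\<sigma>' = filter_var H p a \<Delta>"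
  define x b where "x j = filter_diff p a \<Delta> X j \<omega>" and "b j = filter_diff p a \<Delta> B j \<omega>" for j
  have n': "sqrt (real n) * (1 / real n) = 1 / sqrt (real n)"
    using sqrt_divide_self_eq[of "real n"] by (simp add: divide_inverse)
  have sq: "\<bar>(x j)\<^sup>2 - (b j)\<^sup>2\<bar> \<le> 2 * (c * \<Delta>) * \<bar>b j\<bar> + (c * \<Delta>)\<^sup>2" for j
  proof -
    define d where "d = x j - b j"
    have d: "\<bar>d\<bar> \<le> c * \<Delta>" using c[of j] by (simp add: d_def x_def b_def)
    have "(x j)\<^sup>2 - (b j)\<^sup>2 = 2 * d * b j + d\<^sup>2" by (simp add: d_def power2_eq_square algebra_simps)
    also have "\<bar>\<dots>\<bar> \<le> 2 * \<bar>d\<bar> * \<bar>b j\<bar> + \<bar>d\<bar>\<^sup>2"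
      using abs_triangle_ineq[of "2 * d * b j" "d\<^sup>2"] by (simp add: abs_mult)
    also have "\<dots> \<le> 2 * (c * \<Delta>) * \<bar>b j\<bar> + (c * \<Delta>)\<^sup>2"
      using d by (intro add_mono mult_right_mono power_mono) auto
    finally show ?thesis .
  qed
  have "sqrt (real n) * quad_var H p a n \<Delta> X \<omega> - sqrt (real n) * quad_var H p a n \<Delta> B \<omega>
      = sqrt (real n) * (1 / real n) * (\<Sum>j=1..n - p. ((x j)\<^sup>2 - (b j)\<^sup>2) / \<sigma>')"
    unfolding quad_var_def x_def[symmetric] b_def[symmetric] \<sigma>'_def[symmetric] mult.assoc right_diff_distrib[symmetric] sum_subtractf[symmetric]
    by (simp add: diff_divide_distrib)
  also have "\<dots> = (\<Sum>j=1..n - p. (x j)\<^sup>2 - (b j)\<^sup>2) / (\<sigma>' * sqrt (real n))"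
    unfolding n' sum_divide_distrib[symmetric] by (simp add: mult.commute)
  also have "\<bar>\<dots>\<bar> = \<bar>\<Sum>j=1..n - p. (x j)\<^sup>2 - (b j)\<^sup>2\<bar> / (\<sigma>' * sqrt (real n))"
    using \<sigma> by (simp add: abs_divide abs_mult \<sigma>'_def)
  also have "\<dots> \<le> (\<Sum>j=1..n - p. 2 * (c * \<Delta>) * \<bar>b j\<bar> + (c * \<Delta>)\<^sup>2) / (\<sigma>' * sqrt (real n))"
    using \<sigma> sq by (intro divide_right_mono order_trans[OF sum_abs] sum_mono) (auto simp: \<sigma>'_def)
  finally show ?thesis by (simp add: \<sigma>'_def b_def)
qed

theorem theorem3:
  fixes M :: "'a measure" and B X :: "real \<Rightarrow> 'a \<Rightarrow> real"
    and f :: "real \<Rightarrow> real \<Rightarrow> real" and a :: "nat \<Rightarrow> real" and p :: nat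
    and H x \<alpha> :: real
  assumes H: "0 < H" "H < 1/2"
    and B: "fBm M H B"
    and f: "C01b {0..} f"
    and X: "is_solution M x f B X"
    and a: "is_diff_filter p a"
    and \<alpha>: "\<alpha> > 1 / (2 * (1 - H))"
  shows "clt_variance H p a > 0 \<and>
    conv_in_distr M (\<lambda>n \<omega>. sqrt (real n) * quad_var H p a n (real n powr (-\<alpha>)) X \<omega>)
      (centered_normal (clt_variance H p a))"
proof -
  interpret prob_space M using B by (rule fBm_prob_space)
  note pos = filter_correlation_square_mean(1)[OF H a] and K0 = filter_cov_0_pos[OF H a]
  have a0: "(\<Sum>i\<le>p. a i) = 0" using a by (simp add: is_diff_filter_def)
  obtain K where K: "\<And>s y. 0 \<le> s \<Longrightarrow> \<bar>f s y\<bar> \<le> K"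
  proof -
    obtain f' :: "real \<Rightarrow> real \<Rightarrow> real" where "\<exists>K>0. \<forall>s\<in>{0..}. \<forall>x. \<forall>r\<in>{0..}. \<forall>y. \<bar>f s x\<bar> + \<bar>f' r y\<bar> \<le> K"
      using f[unfolded C01b_def, THEN conjunct2] by fast
    then obtain K where "\<forall>s\<in>{0..}. \<forall>x. \<forall>r\<in>{0..}. \<forall>y. \<bar>f s x\<bar> + \<bar>f' r y\<bar> \<le> K"
      by fast
    then have le: "\<bar>f s y\<bar> + \<bar>f' 0 0\<bar> \<le> K" if "0 \<le> s" for s y
      using that by (meson atLeast_iff order_refl)
    show ?thesis
    proof (rule that)
      show "\<bar>f s y\<bar> \<le> K" if "0 \<le> s" for s y
        using le[OF that, of y] by linarith
    qed
  qed
  have K_nn: "0 \<le> K" using K[of 0 0] by simp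
  define c where "c = (\<Sum>i\<le>p. \<bar>a i\<bar> * (K * real i))"
  have c: "0 \<le> c" unfolding c_def using K_nn by (intro sum_nonneg) auto
  define \<Delta> where "\<Delta> n = real n powr (- \<alpha>)" for n :: nat
  have \<Delta>0: "0 \<le> \<Delta> n" for n by (simp add: \<Delta>_def)
  define \<sigma> where "\<sigma> n = filter_var H p a (\<Delta> n)" for n
  define k where "k = filter_cov H p a 0"
  have \<sigma>_eq: "\<sigma> n = (\<Delta> n) powr (2 * H) * k" for n
    by (simp add: \<sigma>_def k_def filter_var_eq_filter_cov)
  have [measurable]: "B (real i * \<Delta> n) \<in> borel_measurable M" "X (real i * \<Delta> n) \<in> borel_measurable M" for i n
    using fBm_measurable[OF B, of "real i * \<Delta> n"] X \<Delta>0 by (auto simp: is_solution_def)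
  define U where "U Z n \<omega> = sqrt (real n) * quad_var H p a n (\<Delta> n) Z \<omega>" for Z n and \<omega> :: 'a
  define G where "G n \<omega> = (\<Sum>j=1..n - p. 2 * (c * \<Delta> n) * \<bar>filter_diff p a (\<Delta> n) B j \<omega>\<bar> + (c * \<Delta> n)\<^sup>2) / (\<sigma> n * sqrt (real n))" for n \<omega>
  \<comment> \<open>The cross term contributes sqrt n times the mesh size over the standard
    deviation, of order n to the power \<open>1/2 - \<alpha> * (1 - H)\<close>; the squared drift
    contributes that order times a further n to the power
    \<open>- \<alpha> * (1 - H)\<close>.\<close>
  define b where "b n = 2 * c / sqrt k * (real n powr (1/2 - \<alpha> * (1 - H)))
      + c\<^sup>2 / k * (real n powr (1/2 - \<alpha> * (1 - H)) * real n powr (- \<alpha> * (1 - H)))" for n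
  have "conv_in_distr M (U X) (centered_normal (quad_var_limit H p a))"
  proof (rule conv_in_distr_normal_perturb[OF prob_space_axioms _ _ pos, where W = "U B" and G = G and b = b])
    show "U X n \<in> borel_measurable M" "U B n \<in> borel_measurable M" for n
      unfolding U_def quad_var_def filter_diff_def by measurable
    show "conv_in_distr M (U B) (centered_normal (quad_var_limit H p a))"
      unfolding U_def \<Delta>_def by (rule fBm_quad_var_clt[OF H a B])
    \<comment> \<open>The hypothesis on \<open>\<alpha>\<close> is equivalent to this; it also makes
      the exponent \<open>- \<alpha> * (1 - H)\<close> negative.\<close>
    have \<alpha>': "1/2 - \<alpha> * (1 - H) < 0"
      using \<alpha> H by (simp add: field_simps)
    have "(\<lambda>n. real n powr (1/2 - \<alpha> * (1 - H))) \<longlonglongrightarrow> 0"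
      using \<alpha>' by (intro tendsto_neg_powr filterlim_real_sequentially)
    moreover have "(\<lambda>n. real n powr (- \<alpha> * (1 - H))) \<longlonglongrightarrow> 0"
      using \<alpha>' by (intro tendsto_neg_powr filterlim_real_sequentially) simp
    ultimately have "b \<longlonglongrightarrow> 2 * c / sqrt k * 0 + c\<^sup>2 / k * (0 * 0)"
      unfolding b_def by (intro tendsto_intros)
    then show "b \<longlonglongrightarrow> 0" by simp
    fix n :: nat assume n: "0 < n"
    have \<Delta>: "0 < \<Delta> n" using n by (simp add: \<Delta>_def)
    have \<sigma>: "0 < \<sigma> n" using \<Delta> K0 by (simp add: \<sigma>_eq k_def)
    note int = fBm_filter_diff_integrable(1)[OF B \<Delta>0]
    show "integrable M (G n)"
      unfolding G_def using int
      by (intro integrable_divide_zero Bochner_Integration.integrable_sum Bochner_Integration.integrable_add integrable_mult_right integrable_abs) auto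
    show "AE \<omega> in M. \<bar>U X n \<omega> - U B n \<omega>\<bar> \<le> G n \<omega>"
    proof -
      have "AE \<omega> in M. \<forall>t\<ge>0. set_integrable lborel {0..t} (\<lambda>s. f s (X s \<omega>)) \<and>
        X t \<omega> = x + (LINT s:{0..t}|lborel. f s (X s \<omega>)) + B t \<omega>"
        using X by (simp add: is_solution_def)
      then show ?thesis
      proof eventually_elim
        case (elim \<omega>)
        show ?case
          unfolding U_def G_def \<sigma>_def
          using \<sigma> n filter_diff_solution_bound[of a p "\<Delta> n" f K X \<omega> x B, OF a0 \<Delta>0 K elim]
          by (intro quad_var_diff_bound) (auto simp: \<sigma>_def c_def)
      qed
    qed
    show "expectation (G n) \<le> b n"
    proof -
      have "expectation (G n) = (\<Sum>j=1..n - p. 2 * (c * \<Delta> n) * expectation (\<lambda>\<omega>. \<bar>filter_diff p a (\<Delta> n) B j \<omega>\<bar>) + (c * \<Delta> n)\<^sup>2) / (\<sigma> n * sqrt (real n))"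
        unfolding G_def using int
        by (simp add: Bochner_Integration.integral_sum Bochner_Integration.integral_add prob_space)
      also have "\<dots> \<le> (\<Sum>j=1..n - p. 2 * (c * \<Delta> n) * sqrt (\<sigma> n) + (c * \<Delta> n)\<^sup>2) / (\<sigma> n * sqrt (real n))"
        using \<sigma> c \<Delta> fBm_filter_diff_abs_mean[OF B a0 \<Delta>]
        by (intro divide_right_mono sum_mono add_mono mult_left_mono) (auto simp: \<sigma>_def)
      \<comment> \<open>There are \<open>n - p\<close> summands, hence at most n, all equal and
        nonnegative.\<close>
      also have "\<dots> \<le> (real n * (2 * (c * \<Delta> n) * sqrt (\<sigma> n) + (c * \<Delta> n)\<^sup>2)) / (\<sigma> n * sqrt (real n))"
        using \<sigma> c \<Delta> by (intro divide_right_mono) (auto intro!: mult_right_mono add_nonneg_nonneg mult_nonneg_nonneg)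
      also have "\<dots> = sqrt (real n) * (2 * (c * \<Delta> n) / sqrt (\<sigma> n) + (c * \<Delta> n)\<^sup>2 / \<sigma> n)"
      proof -
        \<comment> \<open>With \<open>q\<close> for sqrt n and \<open>s\<close> for the standard
          deviation the identity is free of square roots.\<close>
        have gen: "(q * q * (A * s + E)) / (s * s * q) = q * (A / s + E / (s * s))"
          if "0 < q" "0 < s" for q s A E :: real
          using that by (simp add: field_simps)
        show ?thesis
          using gen[of "sqrt (real n)" "sqrt (\<sigma> n)" "2 * (c * \<Delta> n)" "(c * \<Delta> n)\<^sup>2"] n \<sigma> by simp
      qed
      also have "\<dots> = b n"
      proof -
        have sq: "sqrt (real n) = real n powr (1/2)" by (simp add: powr_half_sqrt)
        have s1: "sqrt (\<sigma> n) = real n powr (- \<alpha> * H) * sqrt k"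
        proof -
          have "sqrt ((\<Delta> n) powr (2 * H)) = real n powr (- \<alpha> * H)"
            by (simp add: \<Delta>_def powr_powr powr_half_sqrt[symmetric])
          then show ?thesis by (simp add: \<sigma>_eq real_sqrt_mult)
        qed
        have s2: "\<sigma> n = real n powr (- 2 * \<alpha> * H) * k"
          by (simp add: \<sigma>_eq \<Delta>_def powr_powr mult_ac)
        have d2: "(\<Delta> n)\<^sup>2 = real n powr (- 2 * \<alpha>)"
          by (simp add: \<Delta>_def power2_eq_square flip: powr_add)
        have e1: "real n powr (1/2) * (\<Delta> n / real n powr (- \<alpha> * H)) = real n powr (1/2 - \<alpha> * (1 - H))"
          unfolding \<Delta>_def powr_diff[symmetric] powr_add[symmetric] by (simp add: algebra_simps)
        have e2: "real n powr (1/2) * (real n powr (- 2 * \<alpha>) / real n powr (- 2 * \<alpha> * H))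
            = real n powr (1/2 - \<alpha> * (1 - H)) * real n powr (- \<alpha> * (1 - H))"
          unfolding powr_diff[symmetric] powr_add[symmetric] by (simp add: algebra_simps)
        have "sqrt (real n) * (2 * (c * \<Delta> n) / sqrt (\<sigma> n) + (c * \<Delta> n)\<^sup>2 / \<sigma> n)
            = 2 * c / sqrt k * (real n powr (1/2) * (\<Delta> n / real n powr (- \<alpha> * H)))
              + c\<^sup>2 / k * (real n powr (1/2) * (real n powr (- 2 * \<alpha>) / real n powr (- 2 * \<alpha> * H)))"
          unfolding s1 power_mult_distrib d2 sq unfolding s2 by (simp add: distrib_left mult_ac)
        then show ?thesis unfolding e1 e2 b_def .
      qed
      finally show ?thesis .
    qed
  qed
  then show ?thesis
    unfolding clt_variance_eq[OF H a B] using pos by (simp add: U_def[abs_def] \<Delta>_def)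
qed

end
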